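(* Let $d\ge1$ and let $\{Z_i(n),\ 1\le i\le n,\ n\ge1\}$ be a triangular array of random vectors in $\mathbb R^d$. For each $n\ge1$, suppose that $Z_1(n),\dots,Z_n(n)$ are independent, $E\,Z_i(n)=0$, and the covariance matrices $\operatorname{Cov}Z_i(n)$ are finite, $1\le i\le n$. Assume also that, as $n\to\infty$, $$\sum_{i=1}^n\operatorname{Cov}Z_i(n)\to\Sigma>0$$ for some $d\times d$ positive definite matrix $\Sigma$, and that the Lindeberg condition holds: for each $\mu>0$, $$\sum_{i=1}^nE\Big(\|Z_i(n)\|^2\,\mathbb 1_{\{\|Z_i(n)\|\ge\mu\}}\Big)\to0,\quad n\to\infty.$$ Then the multivariate Student statistic satisfies $$St_n(Z(n))=\sqrt n\;\overline{Z(n)}\;V_{Z(n)Z(n)}^{-T/2}\xrightarrow{\mathcal D}N(0,I_d),\quad n\to\infty.$$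
   Context: All vectors are row vectors and $\|\cdot\|$ is the Euclidean norm. $\overline{Z(n)}=n^{-1}\sum_{i=1}^nZ_i(n)$ and $V_{Z(n)Z(n)}=(n-1)^{-1}\sum_{i=1}^n(Z_i(n)-\overline{Z(n)})^T(Z_i(n)-\overline{Z(n)})$. $A>0$ means that $A$ is positive definite. For $A>0$, $A^{1/2}$ denotes either the left Cholesky square root (the lower triangular matrix with positive diagonal elements with $A^{1/2}(A^{1/2})^T=A$) or the symmetric positive definite square root; the result is for either choice. $A^{-T/2}=((A^{1/2})^{-1})^T$. The statistic is considered on the events where $V_{Z(n)Z(n)}>0$, whose probabilities tend to one. *)

theory Defs
  imports "HOL-Probability.Probability"
begin

text \<open>
  Elements of \<^typ>\<open>real^'d\<close> are read as row vectors, so matrices act on them from the right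
  by \<^term>\<open>(v*)\<close>, and \<open>outer x y\<close> is the matrix \<open>x\<^sup>T y\<close>.
\<close>

definition outer :: "real^'d \<Rightarrow> real^'d \<Rightarrow> real^'d^'d" where
  "outer x y = (\<chi> j k. x $ j * y $ k)"

definition pos_def :: "real^'d^'d \<Rightarrow> bool" where
  "pos_def A \<longleftrightarrow> transpose A = A \<and> (\<forall>x. x \<noteq> 0 \<longrightarrow> (x v* A) \<bullet> x > 0)"

text \<open>
  The two admissible choices of the matrix square root of \<open>A\<close>. Both are uniquely determined for positive definite \<open>A\<close>
  and are only used for such \<open>A\<close>. Triangularity refers to the linear order on the index type.
\<close>

definition cholesky_sqrt :: "real^('d::{finite,linorder})^('d::{finite,linorder}) \<Rightarrow> real^('d::{finite,linorder})^('d::{finite,linorder})" where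
  "cholesky_sqrt A =
    (THE L. (\<forall>j k. j < k \<longrightarrow> L $ j $ k = 0) \<and> (\<forall>j. L $ j $ j > 0) \<and> L ** transpose L = A)"

definition symmetric_sqrt :: "real^'d^'d \<Rightarrow> real^'d^'d" where
  "symmetric_sqrt A = (THE S. pos_def S \<and> S ** S = A)"

definition sample_mean :: "nat \<Rightarrow> (nat \<Rightarrow> real^'d) \<Rightarrow> real^'d" where
  "sample_mean n z = (1 / real n) *\<^sub>R (\<Sum>i=1..n. z i)"

text \<open>For \<open>n = 1\<close> the factor is \<open>1 / 0 = 0\<close>, so the matrix is zero and not positive definite.\<close>

definition sample_cov :: "nat \<Rightarrow> (nat \<Rightarrow> real^'d) \<Rightarrow> real^'d^'d" where
  "sample_cov n z =
    (1 / (real n - 1)) *\<^sub>R (\<Sum>i=1..n. outer (z i - sample_mean n z) (z i - sample_mean n z))"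

text \<open>
  The multivariate Student statistic for a choice \<open>R\<close> of the matrix square root. It is meaningful
  only where the sample covariance matrix is positive definite; elsewhere it gets the dummy value
  \<open>0\<close>.
\<close>

definition student_stat ::
    "(real^'d^'d \<Rightarrow> real^'d^'d) \<Rightarrow> nat \<Rightarrow> (nat \<Rightarrow> real^'d) \<Rightarrow> real^'d" where
  "student_stat R n z =
    (if pos_def (sample_cov n z)
     then sqrt (real n) *\<^sub>R (sample_mean n z v* transpose (matrix_inv (R (sample_cov n z))))
     else 0)"

definition centred :: "'a measure \<Rightarrow> ('a \<Rightarrow> real^'d) \<Rightarrow> 'a \<Rightarrow> real^'d" where
  "centred M X \<omega> = X \<omega> - integral\<^sup>L M X"

definition cov_finite :: "'a measure \<Rightarrow> ('a \<Rightarrow> real^'d) \<Rightarrow> bool" where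
  "cov_finite M X \<longleftrightarrow> integrable M (\<lambda>\<omega>. outer (centred M X \<omega>) (centred M X \<omega>))"

definition cov_matrix :: "'a measure \<Rightarrow> ('a \<Rightarrow> real^'d) \<Rightarrow> real^'d^'d" where
  "cov_matrix M X = integral\<^sup>L M (\<lambda>\<omega>. outer (centred M X \<omega>) (centred M X \<omega>))"

text \<open>The standard normal law \<open>N(0, I\<^sub>d)\<close>, given by its Lebesgue density.\<close>

definition std_normal_vec :: "(real^'d) measure" where
  "std_normal_vec =
    density lborel (\<lambda>x. ennreal (exp (- (norm x)\<^sup>2 / 2) / sqrt (2 * pi) ^ CARD('d)))"

text \<open>
  Convergence in distribution of the random vectors \<open>X n\<close>, each on its own probability space
  \<open>M n\<close>, to the law \<open>N\<close> (\<^const>\<open>weak_conv_m\<close> covers real random variables only).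
\<close>

definition conv_in_distribution ::
    "(nat \<Rightarrow> 'a measure) \<Rightarrow> (nat \<Rightarrow> 'a \<Rightarrow> 'b::topological_space) \<Rightarrow> 'b measure \<Rightarrow> bool" where
  "conv_in_distribution M X N \<longleftrightarrow>
    (\<forall>f :: 'b \<Rightarrow> real. continuous_on UNIV f \<and> bounded (range f) \<longrightarrow>
      (\<lambda>n. integral\<^sup>L (distr (M n) borel (X n)) f) \<longlonglongrightarrow> integral\<^sup>L N f)"

end

theory Submission
  imports Defs
begin

text \<open>
  Write \<open>S\<^sub>n = \<Sum> Z\<^sub>i\<close> and \<open>A\<^sub>n = n V\<^sub>n\<close>. Since both square roots \<open>R\<close> satisfy \<open>R (c A) = \<surd>c R A\<close>, the
  statistic equals \<open>S\<^sub>n (R A\<^sub>n)\<^sup>-\<^sup>T\<close>. Truncation and the Lindeberg condition give \<open>A\<^sub>n \<rightarrow> \<Sigma>\<close> in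
  \<open>L\<^sup>1\<close>, and the roots are continuous at \<open>\<Sigma>\<close>, so the statistic is asymptotically \<open>S\<^sub>n (R \<Sigma>)\<^sup>-\<^sup>T\<close>.
  The characteristic functions of \<open>S\<^sub>n\<close> converge by Lindeberg's argument applied to \<open>t \<bullet> S\<^sub>n\<close>.
  In place of the Cramer-Wold device, weak convergence follows from tightness and from
  approximating test functions on a ball by bounded trigonometric polynomials.
\<close>

section \<open>Square roots of positive definite matrices\<close>

text \<open>Only second moments of \<open>Z n i\<close> are available, so the entries of
  \<open>outer (Z n i \<omega>) (Z n i \<omega>)\<close> have merely first moments and Chebyshev's
  inequality does not apply to them directly; hence the truncation, and hence convergence in mean.
  The centring in the sample covariance is harmless: it contributes
  \<open>outer (S n \<omega>) (S n \<omega>)\<close> divided by \<open>n\<close>, whose norm has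
  expectation of order 1/n. Each row lives on its own space \<open>M n\<close>, so there is no
  pointwise convergence, and every limit concerns integrals and measures. Both roots are defined by
  \<open>THE\<close>, so existence, uniqueness and continuity have to be settled before anything can
  be said about the statistic. One topological argument serves both, with triangular or symmetric
  matrices as the class; it replaces the Cholesky algorithm as well as the spectral theorem.\<close>

lemma quadratic_form_mult_transpose:
  fixes L :: "real^'d^'d"
  shows "(x v* (L ** transpose L)) \<bullet> x = (norm (x v* L))\<^sup>2"
  by (simp add: vector_matrix_mul_assoc[symmetric] power2_norm_eq_inner dot_lmul_matrix)
     (metis dot_lmul_matrix inner_commute)

text \<open>The quadratic form of \<open>L ** transpose L\<close> at \<open>x\<close> is the squared
  norm of \<open>x v* L\<close>, so positivity can fail only on the left kernel of
  \<open>L\<close>.\<close>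

lemma pos_def_mult_transpose_iff:
  fixes L :: "real^'d^'d"
  shows "pos_def (L ** transpose L) \<longleftrightarrow> (\<forall>x. x v* L = 0 \<longrightarrow> x = 0)"
  unfolding pos_def_def quadratic_form_mult_transpose
  by (auto simp: matrix_transpose_mul)

text \<open>The norm of the type \<open>real^'d^'d\<close> is the Frobenius norm; hence a root is
  bounded through the trace of the matrix it is a root of.\<close>

lemma power2_norm_matrix:
  fixes L :: "real^'d^'d"
  shows "(norm L)\<^sup>2 = trace (L ** transpose L)"
  by (simp add: power2_norm_eq_inner inner_vec_def trace_def matrix_matrix_mult_def transpose_def)

lemma continuous_on_matrix_mult_transpose:
  "continuous_on S (\<lambda>L::real^'d^'d. L ** transpose L)"
  unfolding matrix_matrix_mult_def transpose_def
  by (intro continuous_intros)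

lemma continuous_on_trace: "continuous_on S (trace :: real^'d^'d \<Rightarrow> real)"
  unfolding trace_def by (intro continuous_intros)

lemma subspace_symmetric: "subspace {A :: real^'d^'d. transpose A = A}"
  by (auto simp: subspace_def transpose_def vec_eq_iff)

lemma continuous_on_quadratic_form: "continuous_on S (\<lambda>A::real^'d^'d. (x v* A) \<bullet> x)"
  unfolding vector_matrix_mult_def by (intro continuous_intros)

lemma continuous_on_quadratic_form_vec: "continuous_on S (\<lambda>x. (x v* (A::real^'d^'d)) \<bullet> x)"
  unfolding vector_matrix_mult_def by (intro continuous_intros)

lemma pos_def_scaleR: "c > 0 \<Longrightarrow> pos_def (c *\<^sub>R A) \<longleftrightarrow> pos_def A"
  by (auto simp: pos_def_def transpose_scalar vector_scaleR_matrix_ac zero_less_mult_iff)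

lemma pos_def_mat_1: "pos_def (mat 1 :: real^'d^'d)"
  by (simp add: pos_def_def)

lemma convex_pos_def: "convex {A :: real^'d^'d. pos_def A}"
proof (rule convexI)
  fix A B :: "real^'d^'d" and u v :: real
  assume AB: "A \<in> {A. pos_def A}" "B \<in> {A. pos_def A}" and uv: "0 \<le> u" "0 \<le> v" "u + v = 1"
  have "(x v* (u *\<^sub>R A + v *\<^sub>R B)) \<bullet> x > 0" if "x \<noteq> 0" for x
  proof -
    have "(x v* A) \<bullet> x > 0" "(x v* B) \<bullet> x > 0"
      using AB that by (auto simp: pos_def_def)
    moreover have "(x v* (u *\<^sub>R A + v *\<^sub>R B)) \<bullet> x = u * ((x v* A) \<bullet> x) + v * ((x v* B) \<bullet> x)"
      by (simp add: vector_matrix_mult_add_rdistrib vector_matrix_left_distrib inner_add_left vector_scaleR_matrix_ac)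
    ultimately show ?thesis
      using uv by (smt (verit) mult_nonneg_nonneg mult_pos_pos)
  qed
  moreover have "transpose (u *\<^sub>R A + v *\<^sub>R B) = u *\<^sub>R A + v *\<^sub>R B"
    using AB by (auto simp: pos_def_def transpose_def vec_eq_iff)
  ultimately show "u *\<^sub>R A + v *\<^sub>R B \<in> {A. pos_def A}"
    by (simp add: pos_def_def)
qed

text \<open>The constant is the minimum of the form on the unit sphere, attained by compactness;
  homogeneity extends the bound to all vectors. A uniform constant, unlike pointwise positivity,
  survives small perturbations.\<close>

lemma pos_def_iff_ex_lower_bound:
  fixes A :: "real^'d^'d"
  shows "pos_def A \<longleftrightarrow> transpose A = A \<and> (\<exists>c>0. \<forall>x. (x v* A) \<bullet> x \<ge> c * (norm x)\<^sup>2)"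
proof
  assume A: "pos_def A"
  let ?f = "\<lambda>x. (x v* A) \<bullet> x"
  have "compact (sphere 0 1 :: (real^'d) set)" "sphere 0 1 \<noteq> ({} :: (real^'d) set)"
    by auto
  then obtain x0 where x0: "x0 \<in> sphere 0 1" "\<And>y. y \<in> sphere 0 1 \<Longrightarrow> ?f x0 \<le> ?f y"
    using continuous_attains_inf[OF _ _ continuous_on_quadratic_form_vec[of _ A]] by metis
  have "?f x0 > 0"
    using A x0(1) by (auto simp: pos_def_def dest: spec[of _ x0])
  moreover have "?f x0 * (norm x)\<^sup>2 \<le> ?f x" for x
  proof (cases "x = 0")
    case False
    have "?f x0 \<le> ?f (x /\<^sub>R norm x)"
      using False by (intro x0(2)) auto
    also have "\<dots> = ?f x / (norm x)\<^sup>2"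
      by (simp add: scaleR_vector_matrix_assoc power2_eq_square field_simps)
    finally show ?thesis
      using False by (simp add: field_simps)
  qed auto
  ultimately show "transpose A = A \<and> (\<exists>c>0. \<forall>x. ?f x \<ge> c * (norm x)\<^sup>2)"
    using A by (auto simp: pos_def_def)
next
  assume "transpose A = A \<and> (\<exists>c>0. \<forall>x. (x v* A) \<bullet> x \<ge> c * (norm x)\<^sup>2)"
  then obtain c where c: "transpose A = A" "c > 0" "\<And>x. (x v* A) \<bullet> x \<ge> c * (norm x)\<^sup>2"
    by blast
  have "(x v* A) \<bullet> x > 0" if "x \<noteq> 0" for x
    using c(3)[of x] mult_pos_pos[OF c(2), of "(norm x)\<^sup>2"] that by auto
  then show "pos_def A"
    using c by (simp add: pos_def_def)
qed

text \<open>Cauchy-Schwarz in each row: the operator norm is at most the Frobenius norm.\<close>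

lemma norm_matrix_vector_mult_le:
  fixes A :: "real^'d^'d"
  shows "norm (A *v x) \<le> norm A * norm x"
proof -
  have "\<bar>(A *v x) $ i\<bar> \<le> norm (A $ i) * norm x" for i
    using Cauchy_Schwarz_ineq2[of "A $ i" x] by (simp add: matrix_vector_mul_component)
  then have "norm (A *v x) \<le> L2_set (\<lambda>i. norm (A $ i) * norm x) UNIV"
    unfolding norm_vec_def by (intro L2_set_mono) auto
  also have "\<dots> = norm A * norm x"
    by (simp add: norm_vec_def L2_set_left_distrib)
  finally show ?thesis .
qed

lemma norm_vector_matrix_mult_le:
  fixes A :: "real^'d^'d"
  shows "norm (x v* A) \<le> norm x * norm A"
proof -
  have "(norm (transpose A))\<^sup>2 = (norm A)\<^sup>2"
    by (simp add: power2_norm_matrix trace_mul_sym[of "transpose A"])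
  then show ?thesis
    using norm_matrix_vector_mult_le[of "transpose A" x] by (simp add: mult.commute)
qed

text \<open>A perturbation of norm below \<open>c / 2\<close> lowers the form by at most half of its
  bound \<open>c * (norm x)\<^sup>2\<close>. Symmetry is assumed because \<open>pos_def\<close>
  demands it: positive definite matrices are open only relative to the symmetric ones.\<close>

lemma pos_def_near:
  fixes S :: "real^'d^'d"
  assumes "pos_def S"
  obtains \<delta> where "\<delta> > 0" "\<And>A. transpose A = A \<Longrightarrow> norm (A - S) < \<delta> \<Longrightarrow> pos_def A"
proof -
  from assms obtain c where c: "c > 0" "\<And>x. (x v* S) \<bullet> x \<ge> c * (norm x)\<^sup>2"
    by (auto simp: pos_def_iff_ex_lower_bound)
  have "pos_def A" if A: "transpose A = A" "norm (A - S) < c / 2" for A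
  proof -
    have "(x v* A) \<bullet> x \<ge> (c / 2) * (norm x)\<^sup>2" for x
    proof -
      have "\<bar>(x v* (A - S)) \<bullet> x\<bar> \<le> norm (x v* (A - S)) * norm x"
        by (rule Cauchy_Schwarz_ineq2)
      also have "\<dots> \<le> (norm x * norm (A - S)) * norm x"
        by (intro mult_right_mono norm_vector_matrix_mult_le) auto
      also have "\<dots> = norm (A - S) * (norm x)\<^sup>2"
        by (simp add: power2_eq_square)
      also have "\<dots> \<le> (c / 2) * (norm x)\<^sup>2"
        using A by (intro mult_right_mono) auto
      finally have "(x v* (A - S)) \<bullet> x \<ge> - ((c / 2) * (norm x)\<^sup>2)" by linarith
      moreover have "(x v* A) \<bullet> x = (x v* S) \<bullet> x + (x v* (A - S)) \<bullet> x"
        by (simp add: vector_matrix_mult_diff_rdistrib inner_diff_left)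
      ultimately show ?thesis
        using c(2)[of x] by (simp add: field_simps)
    qed
    then show ?thesis
      using A(1) c(1) by (auto simp: pos_def_iff_ex_lower_bound intro!: exI[of _ "c / 2"])
  qed
  then show ?thesis
    using c(1) that[of "c / 2"] by auto
qed

lemma openin_pos_def: "openin (top_of_set {A :: real^'d^'d. transpose A = A}) {A. pos_def A}"
  unfolding openin_euclidean_subtopology_iff
proof safe
  fix A :: "real^'d^'d"
  assume A: "pos_def A"
  then show "transpose A = A" by (simp add: pos_def_def)
  obtain \<delta> where "\<delta> > 0" "\<And>B. transpose B = B \<Longrightarrow> norm (B - A) < \<delta> \<Longrightarrow> pos_def B"
    using pos_def_near[OF A] by blast
  then show "\<exists>e>0. \<forall>B\<in>{A. transpose A = A}. dist B A < e \<longrightarrow> B \<in> {A. pos_def A}"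
    by (intro exI[of _ \<delta>]) (auto simp: dist_norm)
qed

text \<open>
  Existence of the square root on a class \<open>\<R>\<close> of matrices: \<open>L \<mapsto> L L\<^sup>T\<close> maps \<open>\<R>\<close> injectively onto
  an open (invariance of domain) and closed (\<open>|L|\<^sup>2 = tr (L L\<^sup>T)\<close> makes it proper) subset of
  the convex set of positive definite matrices.
\<close>

lemma sqrt_surj_continuous:
  fixes \<R> U :: "(real^'d^'d) set"
  assumes U: "subspace U" "dim {A :: real^'d^'d. transpose A = A} \<le> dim U"
    and op: "openin (top_of_set U) \<R>"
    and inj: "inj_on (\<lambda>L. L ** transpose L) \<R>"
    and proper: "\<And>L. L \<in> closure \<R> \<Longrightarrow> pos_def (L ** transpose L) \<Longrightarrow> L \<in> \<R>"
    and one: "mat 1 \<in> \<R>"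
    and pd: "\<And>L. L \<in> \<R> \<Longrightarrow> pos_def (L ** transpose L)"
    and r: "\<And>L. L \<in> \<R> \<Longrightarrow> r (L ** transpose L) = L"
  shows "(\<lambda>L. L ** transpose L) ` \<R> = {A. pos_def A}" and "continuous_on {A. pos_def A} r"
proof -
  let ?q = "\<lambda>L :: real^'d^'d. L ** transpose L"
  let ?S = "{A :: real^'d^'d. transpose A = A}" and ?P = "{A :: real^'d^'d. pos_def A}"
  \<comment> \<open>Needed for every relatively open \<open>T\<close>: the image of \<R> itself
    matters for surjectivity, all images for continuity of the inverse \<open>r\<close>.\<close>
  have open_map: "openin (top_of_set ?P) (?q ` T)" if "openin (top_of_set \<R>) T" for T
  proof -
    have T: "T \<subseteq> \<R>" "openin (top_of_set U) T"
      using that op openin_imp_subset openin_trans by blast+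
    have "openin (top_of_set ?S) (?q ` T)"
    proof (rule invariance_of_domain_subspaces[OF T(2) U(1) subspace_symmetric U(2)])
      show "?q \<in> T \<rightarrow> ?S" by (auto simp: matrix_transpose_mul)
      show "inj_on ?q T" using inj T(1) inj_on_subset by blast
    qed (rule continuous_on_matrix_mult_transpose)
    moreover have "?q ` T \<subseteq> ?P" "?P \<subseteq> ?S"
      using T(1) pd by (auto simp: pos_def_def)
    ultimately show ?thesis
      using openin_subset_trans by blast
  qed
  have "closedin (top_of_set ?P) (?q ` \<R>)"
    unfolding closedin_limpt
  proof (intro conjI allI impI)
    show "?q ` \<R> \<subseteq> ?P" using pd by auto
    fix A
    assume "A islimpt ?q ` \<R> \<and> A \<in> ?P"
    then obtain X where X: "\<forall>n. X n \<in> ?q ` \<R>" "pos_def A" "X \<longlonglongrightarrow> A"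
      unfolding islimpt_sequential by blast
    from X(1) obtain L where L: "\<And>n. L n \<in> \<R>" "\<And>n. X n = ?q (L n)"
      unfolding image_iff by metis
    have "(\<lambda>n. trace (X n)) \<longlonglongrightarrow> trace A"
      using continuous_on_tendsto_compose[OF continuous_on_trace[of UNIV] X(3)] by simp
    then obtain B where B: "\<And>n. \<bar>trace (X n)\<bar> \<le> B"
      by (metis convergent_imp_Bseq convergentI BseqE real_norm_def)
    have "(norm (L n))\<^sup>2 \<le> B" for n
      using B[of n] unfolding power2_norm_matrix L(2) by linarith
    then have "norm (L n) \<le> sqrt B" for n
      by (simp add: real_le_rsqrt)
    then have "bounded (range L)"
      by (auto simp: bounded_iff)
    then obtain l \<sigma> where l: "strict_mono \<sigma>" "(L \<circ> \<sigma>) \<longlonglongrightarrow> l"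
      using bounded_imp_convergent_subsequence by blast
    have "(\<lambda>n. ?q ((L \<circ> \<sigma>) n)) \<longlonglongrightarrow> ?q l"
      using continuous_on_tendsto_compose[OF continuous_on_matrix_mult_transpose[of UNIV] l(2)] by simp
    moreover have "(\<lambda>n. ?q ((L \<circ> \<sigma>) n)) \<longlonglongrightarrow> A"
      using LIMSEQ_subseq_LIMSEQ[OF X(3) l(1)] by (simp add: o_def L(2))
    ultimately have "?q l = A" by (rule LIMSEQ_unique)
    \<comment> \<open>The limit is only known to lie in the closure; as \<open>A\<close> is positive
      definite, \<open>proper\<close> brings it back into \<R>.\<close>
    moreover have "l \<in> closure \<R>"
      using l(2) L(1) unfolding closure_sequential by (intro exI[of _ "L \<circ> \<sigma>"]) auto
    ultimately show "A \<in> ?q ` \<R>"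
      using proper X(2) by blast
  qed
  moreover have "openin (top_of_set ?P) (?q ` \<R>)"
    by (rule open_map) simp
  moreover have "connected ?P"
    by (rule convex_connected[OF convex_pos_def])
  \<comment> \<open>A clopen subset of a connected set is empty or everything; \<open>one\<close>
    makes it nonempty.\<close>
  ultimately show eq: "?q ` \<R> = ?P"
    using one unfolding connected_clopen by blast
  show "continuous_on ?P r"
    by (rule continuous_on_inverse_open_map[OF continuous_on_matrix_mult_transpose eq r open_map])
qed

section \<open>The Cholesky square root\<close>

lemma linear_vector_matrix_mult: "linear (\<lambda>x. x v* (A :: real^'d^'d))"
  by (rule linearI) (simp_all add: vector_matrix_left_distrib scaleR_vector_matrix_assoc)

context
  fixes U \<R> :: "(real^('d::{finite,linorder})^('d::{finite,linorder})) set"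
  defines "U \<equiv> {L. \<forall>j k. j < k \<longrightarrow> L $ j $ k = 0}"
    and "\<R> \<equiv> {L. (\<forall>j k. j < k \<longrightarrow> L $ j $ k = 0) \<and> (\<forall>j. L $ j $ j > 0)}"
begin

lemma subspace_lower_triangular: "subspace U"
  by (auto simp: subspace_def U_def)

text \<open>Erasing the entries above the diagonal is linear, and injective on symmetric matrices.
  This supplies the dimension hypothesis of \<open>sqrt_surj_continuous\<close>.\<close>

lemma dim_symmetric_le_lower_triangular: "dim {A :: ((real, 'd) vec, 'd) vec. transpose A = A} \<le> dim U"
proof -
  let ?S = "{A :: ((real, 'd) vec, 'd) vec. transpose A = A}"
  let ?f = "\<lambda>A :: ((real, 'd) vec, 'd) vec. \<chi> j k. if j < k then 0 else A $ j $ k"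
  have "linear ?f"
    by (rule linearI) (auto simp: vec_eq_iff)
  moreover have "inj_on ?f (span ?S)"
    unfolding span_eq_iff[THEN iffD2, OF subspace_symmetric]
  proof (rule inj_onI)
    fix A B :: "((real, 'd) vec, 'd) vec"
    assume AB: "A \<in> ?S" "B \<in> ?S" "?f A = ?f B"
    have "A $ j $ k = B $ j $ k" if "k \<le> j" for j k
      using AB(3) that by (simp add: vec_eq_iff) (metis not_le)
    moreover have "A $ j $ k = A $ k $ j" "B $ j $ k = B $ k $ j" for j k
      using AB(1,2) by (auto simp: vec_eq_iff transpose_def)
    ultimately show "A = B"
      by (metis vec_eq_iff linear)
  qed
  ultimately have "dim ?S = dim (?f ` ?S)"
    by (rule dim_image_eq[symmetric])
  also have "\<dots> \<le> dim U"
    by (rule dim_subset) (auto simp: U_def)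
  finally show ?thesis .
qed

text \<open>If the \<open>j\<close>-th diagonal entry vanished, right multiplication by
  \<open>L\<close> would map the vectors supported on \<open>{..j}\<close> into those supported on
  \<open>{..<j}\<close>, a space of smaller dimension, although positive definiteness makes it
  injective. This excludes zero diagonal entries for limits of matrices in \<R>.\<close>

lemma lower_triangular_diag_nonzero:
  assumes "L \<in> U" and pd: "pos_def (L ** transpose L)"
  shows "L $ j $ j \<noteq> 0"
proof
  assume j: "L $ j $ j = 0"
  let ?W = "\<lambda>I :: 'd set. {x :: (real, 'd) vec. \<forall>i. i \<notin> I \<longrightarrow> x $ i = 0}"
  let ?f = "\<lambda>x :: (real, 'd) vec. x v* L"
  have inj: "inj ?f"
    using pd linear_injective_0[OF linear_vector_matrix_mult[of L]]
    unfolding pos_def_mult_transpose_iff by blast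
  have "(x v* L) $ k = 0" if x: "x \<in> ?W {..j}" and k: "k \<notin> {..<j}" for x k
  proof -
    \<comment> \<open>Triangularity or the support of \<open>x\<close> kills the term, except at
      \<open>i = k = j\<close>, where the vanishing diagonal entry does.\<close>
    have "L $ i $ k * x $ i = 0" for i
    proof (cases "i \<le> j \<and> i \<noteq> k")
      case True
      then have "i < k" using k by auto
      then show ?thesis using assms(1) by (auto simp: U_def)
    next
      case False
      then show ?thesis using x k j by (cases "i = j") auto
    qed
    then show ?thesis
      by (auto simp: vector_matrix_mult_def mult.commute intro!: sum.neutral)
  qed
  then have "?f ` ?W {..j} \<subseteq> ?W {..<j}"
    by blast
  then have "dim (?f ` ?W {..j}) \<le> dim (?W {..<j})"
    by (rule dim_subset)
  then have "dim (?W {..j}) \<le> dim (?W {..<j})"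
    using dim_image_eq[OF linear_vector_matrix_mult[of L] inj_on_subset[OF inj]] by simp
  then have "card {..j} \<le> card {..<j}"
    unfolding dim_vec_eq[symmetric] dim_substandard_cart .
  moreover have "card {..<j} < card {..j}"
    by (rule psubset_card_mono) auto
  ultimately show False by simp
qed

text \<open>The Cholesky recursion: apart from earlier columns, entry \<open>(j, k)\<close> of the
  product involves only \<open>L $ j $ k * L $ k $ k\<close>. Taking \<open>j = k\<close> determines
  the positive diagonal entry, and dividing by it the rest of column \<open>k\<close>.\<close>

lemma inj_on_lower_triangular: "inj_on (\<lambda>L. L ** transpose L) \<R>"
proof (rule inj_onI)
  fix L K :: "((real, 'd) vec, 'd) vec"
  assume LK: "L \<in> \<R>" "K \<in> \<R>" "L ** transpose L = K ** transpose K"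
  have entry: "(A ** transpose A) $ j $ k = (\<Sum>l\<in>{..<k}. A $ j $ l * A $ k $ l) + A $ j $ k * A $ k $ k"
    if "A \<in> \<R>" for A :: "((real, 'd) vec, 'd) vec" and j k
  proof -
    have "(A ** transpose A) $ j $ k = (\<Sum>l\<in>UNIV. A $ j $ l * A $ k $ l)"
      by (simp add: matrix_matrix_mult_def transpose_def)
    also have "\<dots> = (\<Sum>l\<in>{..k}. A $ j $ l * A $ k $ l)"
      using that by (intro sum.mono_neutral_right) (auto simp: \<R>_def not_le)
    also have "{..k} = insert k {..<k}" by auto
    finally show ?thesis by simp
  qed
  have "\<forall>j. L $ j $ k = K $ j $ k" for k
  \<comment> \<open>The index type is an arbitrary finite linear order, so the size of an initial
    segment serves as induction measure.\<close>
  proof (induction k rule: measure_induct_rule[where f = "\<lambda>k. card {..<k}"])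
    case (less k)
    have IH: "L $ j $ l = K $ j $ l" if "l < k" for j l
    proof -
      have "card {..<l} < card {..<k}"
        using that by (intro psubset_card_mono) auto
      then show ?thesis using less by blast
    qed
    have eq: "L $ j $ k * L $ k $ k = K $ j $ k * K $ k $ k" for j
      using entry[OF LK(1), of j k] entry[OF LK(2), of j k] LK(3) IH by simp
    have "L $ k $ k > 0" "K $ k $ k > 0"
      using LK by (auto simp: \<R>_def)
    with eq[of k] have "L $ k $ k = K $ k $ k"
      by (metis power2_eq_square power2_eq_iff_nonneg less_imp_le)
    with eq \<open>K $ k $ k > 0\<close> show ?case
      by auto
  qed
  then show "L = K"
    by (simp add: vec_eq_iff)
qed

lemma cholesky_sqrt_mult_transpose:
  assumes "L \<in> \<R>"
  shows "cholesky_sqrt (L ** transpose L) = L"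
  unfolding cholesky_sqrt_def
proof (rule the_equality)
  show "(\<forall>j k. j < k \<longrightarrow> L $ j $ k = 0) \<and> (\<forall>j. 0 < L $ j $ j) \<and> L ** transpose L = L ** transpose L"
    using assms by (auto simp: \<R>_def)
  fix K
  assume "(\<forall>j k. j < k \<longrightarrow> K $ j $ k = 0) \<and> (\<forall>j. 0 < K $ j $ j) \<and> K ** transpose K = L ** transpose L"
  then show "K = L"
    using assms inj_onD[OF inj_on_lower_triangular, of K L] by (auto simp: \<R>_def)
qed

text \<open>If the left kernel contained a nonzero \<open>x\<close> with last nonzero index
  \<open>m\<close>, coordinate \<open>m\<close> of \<open>x v* L\<close> would be
  \<open>x $ m * L $ m $ m\<close>, since \<open>L $ i $ m\<close> vanishes for
  \<open>i < m\<close>.\<close>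

lemma pos_def_lower_triangular:
  assumes "L \<in> \<R>"
  shows "pos_def (L ** transpose L)"
  unfolding pos_def_mult_transpose_iff
proof safe
  fix x :: "(real, 'd) vec"
  assume x0: "x v* L = 0"
  show "x = 0"
  proof (rule ccontr)
    assume "x \<noteq> 0"
    then have ne: "{i. x $ i \<noteq> 0} \<noteq> {}" by (auto simp: vec_eq_iff)
    define m where "m = Max {i. x $ i \<noteq> 0}"
    have m: "x $ m \<noteq> 0"
      using Max_in[OF _ ne] by (simp add: m_def)
    have m': "x $ i = 0" if "i > m" for i
      using that Max_ge[of "{i. x $ i \<noteq> 0}" i] by (fastforce simp: m_def not_le[symmetric])
    have "(x v* L) $ m = (\<Sum>i\<in>UNIV. x $ i * L $ i $ m)"
      by (simp add: vector_matrix_mult_def)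
    also have "\<dots> = (\<Sum>i\<in>{m}. x $ i * L $ i $ m)"
      using assms m' by (intro sum.mono_neutral_right) (auto simp: \<R>_def neq_iff)
    also have "\<dots> \<noteq> 0"
      using assms m by (auto simp: \<R>_def dest: spec[of _ m])
    finally show False
      using x0 by simp
  qed
qed

lemma cholesky_sqrt_surj_continuous:
  shows "(\<lambda>L. L ** transpose L) ` \<R> = {A. pos_def A}"
    and "continuous_on {A. pos_def A} (cholesky_sqrt :: ((real, 'd) vec, 'd) vec \<Rightarrow> ((real, 'd) vec, 'd) vec)"
proof -
  let ?D = "\<Inter>j. {L :: ((real, 'd) vec, 'd) vec. L $ j $ j > 0}"
  have "open ?D"
    by (intro open_INT ballI open_Collect_less continuous_intros) auto
  moreover have "\<R> = U \<inter> ?D"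
    by (auto simp: \<R>_def U_def)
  ultimately have op: "openin (top_of_set U) \<R>"
    by (simp add: openin_open_Int)
  \<comment> \<open>Limits of \<R> are triangular with diagonals that are only nonnegative; positive
    definiteness of the product makes them positive.\<close>
  have proper: "L \<in> \<R>" if L: "L \<in> closure \<R>" "pos_def (L ** transpose L)" for L
  proof -
    have "closed (U \<inter> {L. \<forall>j. L $ j $ j \<ge> 0})"
      by (intro closed_Int closed_subspace subspace_lower_triangular closed_Collect_all
            closed_Collect_le continuous_intros)
    moreover have "\<R> \<subseteq> U \<inter> {L. \<forall>j. L $ j $ j \<ge> 0}"
      by (auto simp: \<R>_def U_def less_imp_le)
    ultimately have "L \<in> U \<inter> {L. \<forall>j. L $ j $ j \<ge> 0}"
      using L(1) closure_minimal by blast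
    then show ?thesis
      using lower_triangular_diag_nonzero[OF _ L(2)] by (auto simp: \<R>_def U_def less_le)
  qed
  have one: "mat 1 \<in> \<R>"
    by (auto simp: \<R>_def mat_def)
  note * = sqrt_surj_continuous[OF subspace_lower_triangular dim_symmetric_le_lower_triangular op
      inj_on_lower_triangular proper one pos_def_lower_triangular cholesky_sqrt_mult_transpose]
  show "(\<lambda>L. L ** transpose L) ` \<R> = {A. pos_def A}"
    and "continuous_on {A. pos_def A} (cholesky_sqrt :: ((real, 'd) vec, 'd) vec \<Rightarrow> ((real, 'd) vec, 'd) vec)"
    by (rule *; assumption)+
qed

end

section \<open>The symmetric square root\<close>

lemma symmetric_mult_transpose:
  "pos_def (S :: real^'d^'d) \<Longrightarrow> S ** transpose S = S ** S"
  by (simp add: pos_def_def)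

text \<open>The columns of a symmetric \<open>D\<close> are its rows, so each diagonal entry of the
  product is the form of \<open>S\<close> at a row of \<open>D\<close>. For positive definite
  \<open>S\<close> the trace is thus nonnegative, and zero only for \<open>D = 0\<close>.\<close>

lemma trace_mult_quadratic_form:
  fixes D S :: "real^'d^'d"
  assumes "transpose D = D"
  shows "trace (D ** S ** D) = (\<Sum>j\<in>UNIV. (D $ j v* S) \<bullet> (D $ j))"
proof -
  have sym: "D $ j $ k = D $ k $ j" for j k
    using assms by (metis transpose_def vec_lambda_beta)
  show ?thesis
    unfolding trace_def matrix_matrix_mult_def vector_matrix_mult_def inner_vec_def
    by (simp add: sym mult.commute)
qed

text \<open>If \<open>S\<^sup>2 = T\<^sup>2\<close> and \<open>D = S - T\<close>, then \<open>S D + D T = 0\<close>, so \<open>tr (D S D) + tr (D T D) = 0\<close>.\<close>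

lemma inj_on_pos_def: "inj_on (\<lambda>L. L ** transpose L) {S :: real^'d^'d. pos_def S}"
proof (rule inj_onI)
  fix S T :: "real^'d^'d"
  assume "S \<in> {S. pos_def S}" "T \<in> {S. pos_def S}" "S ** transpose S = T ** transpose T"
  then have S: "pos_def S" and T: "pos_def T" and eq: "S ** S = T ** T"
    by (auto simp: symmetric_mult_transpose)
  define D where "D = S - T"
  have D: "transpose D = D"
    using S T by (auto simp: D_def pos_def_def transpose_def vec_eq_iff)
  have "S ** D + D ** T = S ** S - T ** T"
    by (simp add: D_def vec_eq_iff matrix_matrix_mult_def algebra_simps sum_subtractf sum.distrib[symmetric])
  then have "S ** D + D ** T = 0"
    by (simp add: eq)
  then have "trace (D ** (S ** D + D ** T)) = 0"
    by (simp add: trace_def)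
  moreover have "trace (D ** (D ** T)) = trace (D ** T ** D)"
    by (simp add: trace_mul_sym[of D "D ** T"])
  ultimately have 0: "trace (D ** S ** D) + trace (D ** T ** D) = 0"
    by (simp add: matrix_add_ldistrib trace_add matrix_mul_assoc)
  have nonneg: "(D $ j v* A) \<bullet> (D $ j) \<ge> 0" if "pos_def A" for A j
    using that by (cases "D $ j = 0") (auto simp: pos_def_def less_imp_le)
  have "trace (D ** S ** D) \<ge> 0" "trace (D ** T ** D) \<ge> 0"
    unfolding trace_mult_quadratic_form[OF D] by (intro sum_nonneg nonneg S T)+
  with 0 have "(\<Sum>j\<in>UNIV. (D $ j v* S) \<bullet> (D $ j)) = 0"
    unfolding trace_mult_quadratic_form[OF D] by linarith
  then have "(D $ j v* S) \<bullet> (D $ j) = 0" for j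
    using nonneg[OF S] by (simp add: sum_nonneg_eq_0_iff)
  then have "D $ j = 0" for j
    using S unfolding pos_def_def by (metis less_irrefl)
  then have "D = 0"
    by (simp add: vec_eq_iff)
  then show "S = T"
    by (simp add: D_def)
qed

lemma symmetric_sqrt_mult_transpose:
  assumes "pos_def (S :: real^'d^'d)"
  shows "symmetric_sqrt (S ** transpose S) = S"
  unfolding symmetric_sqrt_def
proof (rule the_equality)
  show "pos_def S \<and> S ** S = S ** transpose S"
    using assms by (simp add: symmetric_mult_transpose)
  show "T = S" if "pos_def T \<and> T ** T = S ** transpose S" for T
    using assms that inj_onD[OF inj_on_pos_def, of T S] by (auto simp: symmetric_mult_transpose)
qed

lemma pos_def_mult_transpose:
  assumes "pos_def (S :: real^'d^'d)"
  shows "pos_def (S ** transpose S)"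
  unfolding pos_def_mult_transpose_iff
  using assms by (metis pos_def_def inner_zero_left less_irrefl)

text \<open>A limit of positive definite matrices has a nonnegative form. If the form vanished at
  some nonzero \<open>x\<close>, moving from \<open>x\<close> in the direction \<open>- y\<close>
  with \<open>y = x v* S\<close> would make it negative to first order; \<open>y\<close> is nonzero
  because the assumption on the product makes the left kernel trivial.\<close>

lemma closure_pos_def_invertible:
  fixes S :: "real^'d^'d"
  assumes S: "S \<in> closure {A. pos_def A}" and pd: "pos_def (S ** transpose S)"
  shows "pos_def S"
proof -
  let ?C = "{A :: real^'d^'d. transpose A = A} \<inter> {A. \<forall>x. (x v* A) \<bullet> x \<ge> 0}"
  have "closed ?C"
    by (intro closed_Int closed_subspace subspace_symmetric closed_Collect_all
          closed_Collect_le continuous_on_quadratic_form continuous_intros)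
  moreover have "A \<in> ?C" if "pos_def A" for A
    using that by (auto simp: pos_def_def) (metis inner_zero_right less_eq_real_def)
  ultimately have "S \<in> ?C"
    using S closure_minimal[of "{A. pos_def A}" ?C] by blast
  then have sym: "transpose S = S" and nn: "\<And>x. (x v* S) \<bullet> x \<ge> 0"
    by auto
  have "(x v* S) \<bullet> x > 0" if "x \<noteq> 0" for x
  proof (rule ccontr)
    assume "\<not> (x v* S) \<bullet> x > 0"
    then have x0: "(x v* S) \<bullet> x = 0" using nn[of x] by simp
    define y where "y = x v* S"
    have "y \<noteq> 0"
      using pd that unfolding y_def pos_def_mult_transpose_iff by blast
    have xy: "(x v* S) \<bullet> y = y \<bullet> y" "(y v* S) \<bullet> x = y \<bullet> y"
      by (simp add: y_def) (metis dot_lmul_matrix inner_commute sym transpose_matrix_vector y_def)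
    define q where "q = (y v* S) \<bullet> y"
    have quad: "0 \<le> s\<^sup>2 * q - 2 * s * (y \<bullet> y)" for s
    proof -
      have "0 \<le> ((x - s *\<^sub>R y) v* S) \<bullet> (x - s *\<^sub>R y)" by (rule nn)
      also have "\<dots> = s\<^sup>2 * q - 2 * s * (y \<bullet> y)"
        by (simp add: vector_matrix_mult_diff_distrib scaleR_vector_matrix_assoc inner_diff_left
            inner_diff_right x0 xy q_def power2_eq_square algebra_simps)
      finally show ?thesis .
    qed
    have q: "q \<ge> 0" unfolding q_def by (rule nn)
    have "y \<bullet> y > 0" using \<open>y \<noteq> 0\<close> by simp
    \<comment> \<open>Any positive \<open>s\<close> with \<open>s * q < y \<bullet> y\<close> makes
      the expression in \<open>quad\<close> negative; the 1 in the denominator covers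
      \<open>q = 0\<close>.\<close>
    define s where "s = (y \<bullet> y) / (q + 1)"
    have s: "s > 0" "s * q < y \<bullet> y"
      using q \<open>y \<bullet> y > 0\<close> by (auto simp: s_def field_simps)
    have "s * (s * q - 2 * (y \<bullet> y)) \<ge> 0"
      using quad[of s] by (simp add: power2_eq_square algebra_simps)
    then have "s * q - 2 * (y \<bullet> y) \<ge> 0"
      using s(1) by (simp add: zero_le_mult_iff)
    then show False
      using s(2) \<open>y \<bullet> y > 0\<close> by linarith
  qed
  then show ?thesis
    using sym by (simp add: pos_def_def)
qed

lemma symmetric_sqrt_surj_continuous:
  shows "(\<lambda>L. L ** transpose L) ` {S. pos_def S} = {A :: real^'d^'d. pos_def A}"
    and "continuous_on {A. pos_def A} (symmetric_sqrt :: real^'d^'d \<Rightarrow> real^'d^'d)"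
proof -
  note * = sqrt_surj_continuous[OF subspace_symmetric order_refl openin_pos_def inj_on_pos_def, of symmetric_sqrt]
  show "(\<lambda>L. L ** transpose L) ` {S. pos_def S} = {A :: real^'d^'d. pos_def A}"
    and "continuous_on {A. pos_def A} (symmetric_sqrt :: real^'d^'d \<Rightarrow> real^'d^'d)"
    by (rule *; auto simp: closure_pos_def_invertible pos_def_mat_1 pos_def_mult_transpose
        symmetric_sqrt_mult_transpose)+
qed

text \<open>All that is used about the two roots afterwards. Homogeneity comes from uniqueness, as
  both classes of admissible roots are closed under positive scaling.\<close>

lemma sqrt_properties:
  fixes R :: "real^('d::{finite,linorder})^('d::{finite,linorder}) \<Rightarrow> real^('d::{finite,linorder})^('d::{finite,linorder})"
  assumes "R = cholesky_sqrt \<or> R = symmetric_sqrt"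
  shows "continuous_on {A. pos_def A} R"
    and "pos_def A \<Longrightarrow> R A ** transpose (R A) = A"
    and "pos_def A \<Longrightarrow> c > 0 \<Longrightarrow> R (c *\<^sub>R A) = sqrt c *\<^sub>R R A"
proof -
  let ?q = "\<lambda>L :: ((real, 'd) vec, 'd) vec. L ** transpose L"
  let ?L = "{L :: ((real, 'd) vec, 'd) vec. (\<forall>j k. j < k \<longrightarrow> L $ j $ k = 0) \<and> (\<forall>j. L $ j $ j > 0)}"
  show "continuous_on {A. pos_def A} R"
    using assms cholesky_sqrt_surj_continuous(2) symmetric_sqrt_surj_continuous(2) by auto
  obtain \<R> where \<R>: "?q ` \<R> = {A. pos_def A}" "\<And>L. L \<in> \<R> \<Longrightarrow> R (?q L) = L"
    "\<And>L c. L \<in> \<R> \<Longrightarrow> c > 0 \<Longrightarrow> c *\<^sub>R L \<in> \<R>"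
    using assms
  proof
    assume R: "R = cholesky_sqrt"
    show ?thesis
      by (rule that[of ?L]) (auto simp: R cholesky_sqrt_surj_continuous(1) cholesky_sqrt_mult_transpose)
  next
    assume R: "R = symmetric_sqrt"
    show ?thesis
      by (rule that[of "{A. pos_def A}"])
        (auto simp: R symmetric_sqrt_surj_continuous(1) symmetric_sqrt_mult_transpose pos_def_scaleR)
  qed
  {
    assume "pos_def A"
    then obtain L where L: "L \<in> \<R>" "A = ?q L"
      using \<R>(1) by blast
    then show "R A ** transpose (R A) = A"
      by (simp add: \<R>(2))
    assume c: "c > 0"
    have "?q (sqrt c *\<^sub>R L) = c *\<^sub>R A"
      using c by (simp add: L(2) transpose_scalar scalar_matrix_assoc matrix_scalar_ac flip: real_sqrt_mult)
    then show "R (c *\<^sub>R A) = sqrt c *\<^sub>R R A"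
      using \<R>(2)[OF \<R>(3)[OF L(1), of "sqrt c"]] \<R>(2)[OF L(1)] c L(2) by simp
  }
qed

section \<open>Inverses of matrices and of square roots\<close>

lemma matrix_inv_unique:
  fixes A B :: "real^'d^'d"
  assumes "A ** B = mat 1"
  shows "matrix_inv A = B"
proof -
  have BA: "B ** A = mat 1"
    using assms matrix_left_right_inverse by blast
  have "\<exists>C. A ** C = mat 1 \<and> C ** A = mat 1"
    using assms BA by blast
  then have "A ** matrix_inv A = mat 1"
    unfolding matrix_inv_def by (rule someI2_ex) simp
  then have "B ** (A ** matrix_inv A) = B" by simp
  then show ?thesis
    by (simp add: matrix_mul_assoc BA)
qed

lemma matrix_inv_right:
  fixes A :: "real^'d^'d"
  assumes "invertible A"
  shows "A ** matrix_inv A = mat 1" "matrix_inv A ** A = mat 1"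
  using assms matrix_inv_unique unfolding invertible_def by blast+

lemma continuous_on_det: "continuous_on S f \<Longrightarrow> continuous_on S (\<lambda>x. det (f x :: real^'d^'d))"
  unfolding det_def by (intro continuous_intros)

text \<open>By Cramer's rule the entries of the inverse are quotients of determinants: its columns
  solve the linear systems with unit vectors on the right.\<close>

lemma continuous_on_matrix_inv:
  fixes f :: "'a::topological_space \<Rightarrow> real^'d^'d"
  assumes f: "continuous_on S f" and inv: "\<And>x. x \<in> S \<Longrightarrow> invertible (f x)"
  shows "continuous_on S (\<lambda>x. matrix_inv (f x))"
proof -
  let ?B = "\<lambda>A :: real^'d^'d. \<chi> i k. det (\<chi> a b. if b = i then axis k 1 $ a else A $ a $ b) / det A"
  have "matrix_inv A = ?B A" if "invertible A" for A :: "real^'d^'d"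
  proof -
    have "matrix_inv A $ i $ k = (matrix_inv A *v axis k 1) $ i" for i k
      by (simp add: matrix_vector_mult_basis column_def)
    moreover have "A *v (matrix_inv A *v axis k 1) = axis k 1" for k
      using matrix_inv_right(1)[OF that] by (simp add: matrix_vector_mul_assoc)
    then have "matrix_inv A *v axis k 1 = (\<chi> i. det (\<chi> a b. if b = i then axis k 1 $ a else A $ a $ b) / det A)" for k
      using cramer[of A] that invertible_det_nz by blast
    ultimately show ?thesis
      by (simp add: vec_eq_iff)
  qed
  moreover have "continuous_on S (\<lambda>x. ?B (f x))"
  proof -
    have "continuous_on S (\<lambda>x. if b = i then axis k 1 $ a else f x $ a $ b)" for a b i k
      by (cases "b = i") (auto intro!: continuous_intros f)
    then show ?thesis
      using inv by (intro continuous_on_vec_lambda continuous_on_divide continuous_on_det f)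
        (auto simp: invertible_det_nz)
  qed
  ultimately show ?thesis
    using inv by (simp cong: continuous_on_cong)
qed

lemma invertible_sqrt:
  fixes L :: "real^'d^'d"
  assumes "pos_def (L ** transpose L)"
  shows "invertible L"
proof -
  have "\<exists>B. B ** transpose L = mat 1"
    using assms unfolding pos_def_mult_transpose_iff by (simp add: matrix_left_invertible_ker)
  then have "invertible (transpose L)"
    by (simp add: invertible_left_inverse)
  then show ?thesis
    using transpose_invertible by fastforce
qed

text \<open>The third fact says that normalizing a vector with covariance \<open>A\<close> by the
  inverse root gives identity covariance: \<open>u = t v* matrix_inv (R A)\<close> satisfies
  \<open>u v* R A = t\<close>. It turns the limiting exponent of the characteristic function into
  that of the standard normal law.\<close>

lemma inverse_sqrt_properties:
  fixes R :: "real^('d::{finite,linorder})^('d::{finite,linorder}) \<Rightarrow> real^('d::{finite,linorder})^('d::{finite,linorder})"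
  assumes R: "R = cholesky_sqrt \<or> R = symmetric_sqrt"
  shows "continuous_on {A. pos_def A} (\<lambda>A. matrix_inv (R A))"
    and "pos_def A \<Longrightarrow> c > 0 \<Longrightarrow> matrix_inv (R (c *\<^sub>R A)) = (1 / sqrt c) *\<^sub>R matrix_inv (R A)"
    and "pos_def A \<Longrightarrow> ((t v* matrix_inv (R A)) v* A) \<bullet> (t v* matrix_inv (R A)) = (norm t)\<^sup>2"
proof -
  have inv: "invertible (R A)" if "pos_def A" for A
    using that sqrt_properties(2)[OF R that] by (intro invertible_sqrt) simp
  show "continuous_on {A. pos_def A} (\<lambda>A. matrix_inv (R A))"
    using sqrt_properties(1)[OF R] inv by (intro continuous_on_matrix_inv) auto
  {
    assume A: "pos_def A"
    note A_inv = matrix_inv_right[OF inv[OF A]]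
    show "matrix_inv (R (c *\<^sub>R A)) = (1 / sqrt c) *\<^sub>R matrix_inv (R A)" if "c > 0"
      using that A A_inv
      by (intro matrix_inv_unique)
         (simp add: sqrt_properties(3)[OF R A] scalar_matrix_assoc[symmetric] matrix_scalar_ac)
    have "(t v* matrix_inv (R A)) v* R A = t"
      by (simp add: vector_matrix_mul_assoc A_inv)
    then show "((t v* matrix_inv (R A)) v* A) \<bullet> (t v* matrix_inv (R A)) = (norm t)\<^sup>2"
      using quadratic_form_mult_transpose[of "t v* matrix_inv (R A)" "R A"]
      by (simp add: sqrt_properties(2)[OF R A])
  }
qed

section \<open>Convergence of characteristic functions on Euclidean spaces\<close>

text \<open>The span of the characters of the space, with arbitrary frequency vectors. Products stay
  inside because frequencies add, and convergence of characteristic functions extends to the span by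
  linearity.\<close>

inductive trig_poly :: "('b::real_inner \<Rightarrow> complex) \<Rightarrow> bool" where
  monom: "trig_poly (\<lambda>x. a * iexp (t \<bullet> x))"
| add: "trig_poly f \<Longrightarrow> trig_poly g \<Longrightarrow> trig_poly (\<lambda>x. f x + g x)"

lemma trig_poly_const: "trig_poly (\<lambda>x. a)"
  using trig_poly.monom[of a 0] by simp

lemma trig_poly_mult: "trig_poly f \<Longrightarrow> trig_poly g \<Longrightarrow> trig_poly (\<lambda>x. f x * g x)"
proof (induction rule: trig_poly.induct)
  case (monom a t)
  then show ?case
  proof (induction rule: trig_poly.induct)
    case (monom b s)
    have "(\<lambda>x. a * iexp (t \<bullet> x) * (b * iexp (s \<bullet> x))) = (\<lambda>x. (a * b) * iexp ((t + s) \<bullet> x))"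
      by (simp add: fun_eq_iff inner_add_left exp_add ring_distribs)
    then show ?case
      using trig_poly.monom[of "a * b" "t + s"] by simp
  next
    case (add f g)
    then show ?case
      using trig_poly.add by (fastforce simp: distrib_left)
  qed
next
  case (add f g)
  then show ?case
    using trig_poly.add by (fastforce simp: distrib_right)
qed

lemma trig_poly_sum:
  "finite I \<Longrightarrow> (\<And>i. i \<in> I \<Longrightarrow> trig_poly (f i)) \<Longrightarrow> trig_poly (\<lambda>x. \<Sum>i\<in>I. f i x)"
  by (induction I rule: finite_induct) (auto intro: trig_poly_const trig_poly.add)

lemma trig_poly_sin: "trig_poly (\<lambda>x. complex_of_real (sin (c * (x \<bullet> b))))"
proof -
  have *: "complex_of_real (sin (c * (x \<bullet> b))) =
      (1 / (2 * \<i>)) * iexp ((c *\<^sub>R b) \<bullet> x) + (- 1 / (2 * \<i>)) * iexp ((- c *\<^sub>R b) \<bullet> x)" for x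
    by (simp add: complex_eq_iff inner_commute Re_exp Im_exp)
  show ?thesis
    unfolding * by (intro trig_poly.intros)
qed

text \<open>Serves the polynomials of the Stone-Weierstrass theorem, composed with coordinatewise
  sines. A linear function is reduced to its values on the basis.\<close>

lemma trig_poly_polynomial_sin:
  fixes g :: "'b::euclidean_space \<Rightarrow> real"
  assumes "real_polynomial_function g"
  shows "trig_poly (\<lambda>x::'b. complex_of_real (g (\<Sum>b\<in>Basis. sin (c * (x \<bullet> b)) *\<^sub>R b)))"
  using assms
proof induction
  case (linear f)
  have "f (\<Sum>b\<in>Basis. sin (c * (x \<bullet> b)) *\<^sub>R b) = (\<Sum>b\<in>Basis. sin (c * (x \<bullet> b)) * f b)" for x :: 'b
    using bounded_linear.linear[OF linear] by (simp add: linear_sum linear_scale)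
  then show ?case
    by (simp add: trig_poly_sum trig_poly_mult trig_poly_sin trig_poly_const)
qed (simp_all add: trig_poly_const trig_poly.add trig_poly_mult)

lemma trig_poly_measurable [measurable]:
  fixes p :: "'b::euclidean_space \<Rightarrow> complex"
  assumes "trig_poly p" shows "p \<in> borel_measurable borel"
  using assms by induction auto

text \<open>
  The substitution \<open>y\<^sub>b = sin (x\<^sub>b / K)\<close> is injective on the ball of radius \<open>K\<close> and maps the
  whole space into a compact cube, so an approximation on the cube is also bounded off the ball.
\<close>

lemma trig_poly_approx:
  fixes f :: "'b::euclidean_space \<Rightarrow> real"
  assumes f: "continuous_on UNIV f" "\<And>x. \<bar>f x\<bar> \<le> B" and "K > 0" "e > 0"
  obtains p where "trig_poly (\<lambda>x. complex_of_real (p x))"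
    "\<And>x. norm x \<le> K \<Longrightarrow> \<bar>f x - p x\<bar> \<le> e" "\<And>x. \<bar>p x\<bar> \<le> B + e"
proof -
  let ?C = "cbox (- One) One :: 'b set"
  \<comment> \<open>The inverse substitution, continuous on the cube because \<open>arcsin\<close>
    is continuous on [-1, 1]. It takes only values of \<open>f\<close>, which is how the bound
    \<open>B\<close> is inherited.\<close>
  define h where "h = (\<lambda>y::'b. f (\<Sum>b\<in>Basis. (K * arcsin (y \<bullet> b)) *\<^sub>R b))"
  let ?E = "\<lambda>x::'b. \<Sum>b\<in>Basis. sin ((1 / K) * (x \<bullet> b)) *\<^sub>R b"
  have "continuous_on ?C h"
    unfolding h_def
    by (intro continuous_on_compose2[OF f(1)] continuous_intros) (auto simp: mem_box)
  then obtain g where g: "real_polynomial_function g" "\<And>y. y \<in> ?C \<Longrightarrow> \<bar>h y - g y\<bar> < e"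
    using Stone_Weierstrass_real_polynomial_function[of ?C h e] \<open>e > 0\<close> by auto
  have E: "?E x \<in> ?C" for x
    by (auto simp: mem_box)
  show ?thesis
  proof (rule that[of "\<lambda>x. g (?E x)"])
    show "trig_poly (\<lambda>x. complex_of_real (g (?E x)))"
      by (rule trig_poly_polynomial_sin[OF g(1)])
    show "\<bar>g (?E x)\<bar> \<le> B + e" for x
      using g(2)[OF E[of x]] f(2) unfolding h_def by (smt (verit))
    show "\<bar>f x - g (?E x)\<bar> \<le> e" if x: "norm x \<le> K" for x
    proof -
      have "K * arcsin (sin (x \<bullet> b / K)) = x \<bullet> b" if "b \<in> Basis" for b
      proof -
        have "\<bar>x \<bullet> b\<bar> \<le> K"
          using Basis_le_norm[OF that, of x] x by linarith
        \<comment> \<open>Since 1 is less than \<open>pi / 2\<close>, \<open>arcsin\<close> inverts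
          \<open>sin\<close> at this argument.\<close>
        then have "\<bar>x \<bullet> b / K\<bar> \<le> 1"
          using \<open>K > 0\<close> by (simp add: abs_divide)
        then have "arcsin (sin (x \<bullet> b / K)) = x \<bullet> b / K"
          using pi_half_gt_zero pi_ge_two by (intro arcsin_sin) linarith+
        then show ?thesis using \<open>K > 0\<close> by simp
      qed
      then have "h (?E x) = f x"
        unfolding h_def by (simp add: euclidean_representation cong: sum.cong)
      then show ?thesis
        using g(2)[OF E[of x]] by simp
    qed
  qed
qed

lemma trig_poly_bounded:
  assumes "trig_poly p"
  shows "\<exists>B. \<forall>x. norm (p x) \<le> B"
  using assms
proof induction
  case (monom a t)
  then show ?case
    by (intro exI[of _ "norm a"]) (simp add: norm_mult)
next
  case (add f g)
  then obtain B C where "\<forall>x. norm (f x) \<le> B" "\<forall>x. norm (g x) \<le> C" by auto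
  then show ?case
    by (intro exI[of _ "B + C"]) (meson add_mono norm_triangle_le)
qed

lemma (in prob_space) integrable_trig_poly:
  fixes p :: "'b::euclidean_space \<Rightarrow> complex"
  assumes p: "trig_poly p" and [measurable]: "X \<in> borel_measurable M"
  shows "integrable M (\<lambda>\<omega>. p (X \<omega>))"
proof -
  obtain B where "\<And>x. norm (p x) \<le> B"
    using trig_poly_bounded[OF p] by auto
  moreover have "(\<lambda>\<omega>. p (X \<omega>)) \<in> borel_measurable M"
    using trig_poly_measurable[OF p] by measurable
  ultimately show ?thesis
    by (intro integrable_const_bound[of _ B]) auto
qed

text \<open>Used for arrays in which nothing is known about \<open>M 0\<close>, hence the eventual
  form of hypothesis \<open>X\<close>.\<close>

lemma trig_poly_integral_tendsto:
  fixes X :: "nat \<Rightarrow> 'a \<Rightarrow> 'b::euclidean_space"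
  assumes X: "\<forall>\<^sub>F n in sequentially. prob_space (M n) \<and> X n \<in> borel_measurable (M n)"
    and N: "prob_space N" "sets N = sets borel"
    and char: "\<And>t. (\<lambda>n. CLINT \<omega>|M n. iexp (t \<bullet> X n \<omega>)) \<longlonglongrightarrow> (CLINT x|N. iexp (t \<bullet> x))"
    and p: "trig_poly p"
  shows "(\<lambda>n. CLINT \<omega>|M n. p (X n \<omega>)) \<longlonglongrightarrow> (CLINT x|N. p x)"
  using p
proof induction
  case (monom a t)
  show ?case
    by (simp add: tendsto_mult_left char)
next
  case (add f g)
  have id: "(\<lambda>x. x) \<in> borel_measurable N"
    using N(2) by (simp add: measurable_ident_sets)
  have "(CLINT x|N. f x + g x) = (CLINT x|N. f x) + (CLINT x|N. g x)"
    using prob_space.integrable_trig_poly[OF N(1) _ id] add.hyps by (intro Bochner_Integration.integral_add)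
  moreover have "\<forall>\<^sub>F n in sequentially.
      (CLINT \<omega>|M n. f (X n \<omega>)) + (CLINT \<omega>|M n. g (X n \<omega>)) = (CLINT \<omega>|M n. f (X n \<omega>) + g (X n \<omega>))"
    using X
  proof eventually_elim
    case (elim n)
    then show ?case
      using add.hyps
      by (intro Bochner_Integration.integral_add[symmetric] prob_space.integrable_trig_poly) auto
  qed
  ultimately show ?case
    using Lim_transform_eventually[OF tendsto_add[OF add.IH]] by simp
qed

text \<open>Split at the ball of radius \<open>K\<close>: inside it the integrands differ by at most
  \<open>e\<close>; outside by at most \<open>2 * B + e\<close>, on an event of probability at most
  \<open>e\<close>.\<close>

lemma (in prob_space) expectation_diff_le:
  fixes X :: "'a \<Rightarrow> 'b::real_normed_vector" and f p :: "'b \<Rightarrow> real"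
  assumes [measurable]: "X \<in> borel_measurable M" "f \<in> borel_measurable borel" "p \<in> borel_measurable borel"
    and f: "\<And>x. \<bar>f x\<bar> \<le> B" and p: "\<And>x. \<bar>p x\<bar> \<le> B + e"
    and fp: "\<And>x. norm x \<le> K \<Longrightarrow> \<bar>f x - p x\<bar> \<le> e"
    and K: "prob {\<omega> \<in> space M. norm (X \<omega>) > K} \<le> e" and "e > 0"
  shows "\<bar>expectation (\<lambda>\<omega>. f (X \<omega>)) - expectation (\<lambda>\<omega>. p (X \<omega>))\<bar> \<le> e + (2 * B + e) * e"
proof -
  have B: "B \<ge> 0" using f[of 0] by linarith
  let ?A = "{\<omega> \<in> space M. norm (X \<omega>) > K}"
  have A [measurable]: "?A \<in> sets M" by measurable
  have int: "integrable M (\<lambda>\<omega>. f (X \<omega>))" "integrable M (\<lambda>\<omega>. p (X \<omega>))"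
    using f by (intro integrable_const_bound[of _ B]; simp)
      (use p in \<open>intro integrable_const_bound[of _ "B + e"]; simp\<close>)
  have intA: "integrable M (\<lambda>\<omega>. (2 * B + e) * indicator ?A \<omega> :: real)"
    by (intro integrable_mult_right integrable_real_indicator) (auto simp: less_top[symmetric])
  have le: "\<bar>f (X \<omega>) - p (X \<omega>)\<bar> \<le> e + (2 * B + e) * indicator ?A \<omega>" if "\<omega> \<in> space M" for \<omega>
  proof (cases "norm (X \<omega>) \<le> K")
    case True
    then show ?thesis
      using fp[OF True] by simp
  next
    case False
    then show ?thesis
      using f[of "X \<omega>"] p[of "X \<omega>"] that \<open>e > 0\<close> by simp
  qed
  have "\<bar>expectation (\<lambda>\<omega>. f (X \<omega>)) - expectation (\<lambda>\<omega>. p (X \<omega>))\<bar> = \<bar>expectation (\<lambda>\<omega>. f (X \<omega>) - p (X \<omega>))\<bar>"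
    using int by simp
  also have "\<dots> \<le> expectation (\<lambda>\<omega>. \<bar>f (X \<omega>) - p (X \<omega>)\<bar>)"
    by (rule integral_abs_bound)
  also have "\<dots> \<le> expectation (\<lambda>\<omega>. e + (2 * B + e) * indicator ?A \<omega>)"
    using int le intA by (intro integral_mono integrable_abs Bochner_Integration.integrable_add) auto
  also have "\<dots> = e + (2 * B + e) * prob ?A"
    using intA by (subst Bochner_Integration.integral_add) (auto simp: prob_space)
  also have "\<dots> \<le> e + (2 * B + e) * e"
    using K B \<open>e > 0\<close> by (intro add_left_mono mult_left_mono) auto
  finally show ?thesis .
qed

text \<open>Continuity from above: the events for integer radii decrease to the empty set.\<close>

lemma (in prob_space) ex_prob_norm_le:
  fixes X :: "'a \<Rightarrow> 'b::real_normed_vector"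
  assumes [measurable]: "X \<in> borel_measurable M" and "e > 0"
  shows "\<exists>K>0. prob {\<omega> \<in> space M. norm (X \<omega>) > K} \<le> e"
proof -
  let ?A = "\<lambda>n::nat. {\<omega> \<in> space M. norm (X \<omega>) > real n}"
  have "(\<lambda>n. prob (?A n)) \<longlonglongrightarrow> prob (\<Inter>n. ?A n)"
    by (intro finite_Lim_measure_decseq) (auto simp: decseq_def)
  moreover have "(\<Inter>n. ?A n) = {}"
    by (auto simp: not_less) (meson not_le real_arch_simple)
  ultimately have "(\<lambda>n. prob (?A n)) \<longlonglongrightarrow> 0" by simp
  then have "\<forall>\<^sub>F n in sequentially. prob (?A n) < e"
    using \<open>e > 0\<close> by (rule order_tendstoD)
  then have "\<forall>\<^sub>F n in sequentially. prob (?A n) < e \<and> n > 0"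
    using eventually_gt_at_top[of "0::nat"] by (rule eventually_conj)
  then obtain n where "prob (?A n) < e" "n > 0"
    by (metis (mono_tags, lifting) eventually_sequentially order_refl)
  then show ?thesis
    by (intro exI[of _ "real n"]) auto
qed

text \<open>Up to probability \<open>e\<close>, both \<open>X n\<close> and \<open>N\<close> stay in
  one ball; there a test function is replaced by a trigonometric polynomial \<open>p\<close>, whose
  expectations converge. The global bound on \<open>p\<close> controls the error outside the
  ball.\<close>

lemma conv_in_distribution_by_char:
  fixes X :: "nat \<Rightarrow> 'a \<Rightarrow> 'b::euclidean_space"
  assumes X: "\<forall>\<^sub>F n in sequentially. prob_space (M n) \<and> X n \<in> borel_measurable (M n)"
    and N: "prob_space N" "sets N = sets borel"
    and char: "\<And>t. (\<lambda>n. CLINT \<omega>|M n. iexp (t \<bullet> X n \<omega>)) \<longlonglongrightarrow> (CLINT x|N. iexp (t \<bullet> x))"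
    and tight: "\<And>e. e > 0 \<Longrightarrow>
      \<exists>K. \<forall>\<^sub>F n in sequentially. measure (M n) {\<omega> \<in> space (M n). norm (X n \<omega>) > K} \<le> e"
  shows "conv_in_distribution M X N"
  unfolding conv_in_distribution_def
proof (intro allI impI)
  fix f :: "'b \<Rightarrow> real"
  assume "continuous_on UNIV f \<and> bounded (range f)"
  then obtain B where f: "continuous_on UNIV f" "\<And>x. \<bar>f x\<bar> \<le> B"
    by (auto simp: bounded_iff)
  then have B: "B \<ge> 0" by (meson abs_ge_zero order_trans)
  have fm [measurable]: "f \<in> borel_measurable borel"
    by (rule borel_measurable_continuous_onI[OF f(1)])
  have id: "(\<lambda>x. x) \<in> borel_measurable N"
    using N(2) by (simp add: measurable_ident_sets)
  have approx: "\<forall>\<^sub>F n in sequentially. \<bar>(\<integral>\<omega>. f (X n \<omega>) \<partial>M n) - (\<integral>x. f x \<partial>N)\<bar> < 2 * (e + (2 * B + e) * e) + e"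
    if e: "e > 0" for e
  proof -
    obtain K1 where K1: "\<forall>\<^sub>F n in sequentially. measure (M n) {\<omega> \<in> space (M n). norm (X n \<omega>) > K1} \<le> e"
      using tight[OF e] by auto
    obtain K2 where K2: "K2 > 0" "measure N {x \<in> space N. norm x > K2} \<le> e"
      using prob_space.ex_prob_norm_le[OF N(1) id e] by auto
    \<comment> \<open>One radius for both laws, so that the same \<open>p\<close> serves under
      \<open>M n\<close> and under \<open>N\<close>.\<close>
    define K where "K = max K1 K2"
    have K: "K \<ge> K1" "K \<ge> K2" "K > 0" using K2 by (auto simp: K_def)
    obtain p where p: "trig_poly (\<lambda>x. complex_of_real (p x))"
      "\<And>x. norm x \<le> K \<Longrightarrow> \<bar>f x - p x\<bar> \<le> e" "\<And>x. \<bar>p x\<bar> \<le> B + e"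
      using trig_poly_approx[OF f K(3) e] by blast
    have pm [measurable]: "p \<in> borel_measurable borel"
      using measurable_compose[OF trig_poly_measurable[OF p(1)] borel_measurable_Re] by simp
    have "(\<lambda>n. CLINT \<omega>|M n. complex_of_real (p (X n \<omega>))) \<longlonglongrightarrow> (CLINT x|N. complex_of_real (p x))"
      by (rule trig_poly_integral_tendsto[OF X N char p(1)])
    then have "(\<lambda>n. \<integral>\<omega>. p (X n \<omega>) \<partial>M n) \<longlonglongrightarrow> (\<integral>x. p x \<partial>N)"
      by (simp add: tendsto_of_real_iff)
    then have ev: "\<forall>\<^sub>F n in sequentially. \<bar>(\<integral>\<omega>. p (X n \<omega>) \<partial>M n) - (\<integral>x. p x \<partial>N)\<bar> < e"
      using e by (auto simp: tendsto_iff dist_real_def)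
    have "measure N {x \<in> space N. norm x > K} \<le> measure N {x \<in> space N. norm x > K2}"
    proof -
      interpret N: prob_space N by fact
      note id[measurable]
      show ?thesis
        using K by (intro N.finite_measure_mono) auto
    qed
    then have Nb: "\<bar>(\<integral>x. f x \<partial>N) - (\<integral>x. p x \<partial>N)\<bar> \<le> e + (2 * B + e) * e"
      using K2 e p(2) by (intro prob_space.expectation_diff_le[OF N(1) id fm pm f(2) p(3), where K = K]) auto
    have tri: "\<bar>a - b\<bar> \<le> d \<Longrightarrow> \<bar>c - q\<bar> \<le> d \<Longrightarrow> \<bar>b - q\<bar> < r \<Longrightarrow> \<bar>a - c\<bar> < 2 * d + r" for a b c d q r :: real
      by linarith
    from X K1 ev show ?thesis
    proof eventually_elim
      case (elim n)
      then interpret prob_space "M n" by simp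
      have [measurable]: "X n \<in> borel_measurable (M n)" using elim by simp
      have "prob {\<omega> \<in> space (M n). norm (X n \<omega>) > K} \<le> prob {\<omega> \<in> space (M n). norm (X n \<omega>) > K1}"
        using K by (intro finite_measure_mono) auto
      then have "\<bar>(\<integral>\<omega>. f (X n \<omega>) \<partial>M n) - (\<integral>\<omega>. p (X n \<omega>) \<partial>M n)\<bar> \<le> e + (2 * B + e) * e"
        using elim e p(2) by (intro expectation_diff_le[OF _ fm pm f(2) p(3), where K = K]) auto
      then show ?case
        using elim by (intro tri[OF _ Nb]) auto
    qed
  qed
  have "(\<lambda>n. \<integral>\<omega>. f (X n \<omega>) \<partial>M n) \<longlonglongrightarrow> (\<integral>x. f x \<partial>N)"
  proof (rule tendstoI)
    fix \<epsilon> :: real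
    assume \<epsilon>: "\<epsilon> > 0"
    \<comment> \<open>The total error \<open>2 * (e + (2 * B + e) * e) + e\<close> equals
      \<open>3 * e + 4 * B * e + 2 * e\<^sup>2\<close>, which for \<open>e \<le> 1\<close> is at
      most \<open>(5 + 4 * B) * e\<close>.\<close>
    define e where "e = min 1 (\<epsilon> / (5 + 4 * B))"
    have e: "e > 0" "e \<le> 1" "e \<le> \<epsilon> / (5 + 4 * B)"
      using \<epsilon> B by (auto simp: e_def)
    have "e * e \<le> 1 * e"
      using e by (intro mult_right_mono) auto
    then have "2 * (e + (2 * B + e) * e) + e \<le> e * (5 + 4 * B)"
      by (simp add: algebra_simps)
    also have "\<dots> \<le> \<epsilon>" using e(3) B by (simp add: pos_le_divide_eq)
    finally show "\<forall>\<^sub>F n in sequentially. dist (\<integral>\<omega>. f (X n \<omega>) \<partial>M n) (\<integral>x. f x \<partial>N) < \<epsilon>"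
      using approx[OF e(1)] by (auto simp: dist_real_def elim!: eventually_mono)
  qed
  then show "(\<lambda>n. integral\<^sup>L (distr (M n) borel (X n)) f) \<longlonglongrightarrow> integral\<^sup>L N f"
    by (rule Lim_transform_eventually) (use X in eventually_elim, simp add: integral_distr)
qed

section \<open>The standard normal law\<close>

lemma std_normal_vec_density:
  "exp (- (norm (x::real^'d))\<^sup>2 / 2) / sqrt (2 * pi) ^ CARD('d) = (\<Prod>b\<in>Basis. std_normal_density (x \<bullet> b))"
proof -
  have "(norm x)\<^sup>2 = (\<Sum>b\<in>Basis. (x \<bullet> b)\<^sup>2)"
    unfolding power2_norm_eq_inner by (subst euclidean_inner) (simp add: power2_eq_square)
  then have "exp (- (norm x)\<^sup>2 / 2) = (\<Prod>b\<in>Basis. exp (- (x \<bullet> b)\<^sup>2 / 2))"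
    by (simp add: exp_sum[symmetric] sum_negf sum_divide_distrib)
  then show ?thesis
    by (simp add: std_normal_density_def prod_dividef)
qed

text \<open>Fubini: by \<open>lborel_eq\<close>, Lebesgue measure is the image of the product of
  one-dimensional ones under the coordinate map \<open>?T\<close>.\<close>

lemma integral_lborel_prod:
  fixes f :: "'b::euclidean_space \<Rightarrow> real \<Rightarrow> complex"
  assumes "\<And>b. b \<in> Basis \<Longrightarrow> integrable lborel (f b)"
  shows "integrable lborel (\<lambda>x. \<Prod>b\<in>Basis. f b (x \<bullet> b))"
    and "(CLINT x|lborel. (\<Prod>b\<in>Basis. f b (x \<bullet> b))) = (\<Prod>b\<in>Basis. CLINT x|lborel. f b x)"
proof -
  interpret P: product_sigma_finite "\<lambda>b::'b. lborel :: real measure" ..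
  have fm [measurable]: "f b \<in> borel_measurable borel" if "b \<in> Basis" for b
    using assms[OF that] borel_measurable_integrable by fastforce
  let ?T = "\<lambda>y. \<Sum>b\<in>Basis. y b *\<^sub>R (b::'b)"
  have T: "?T \<in> measurable (\<Pi>\<^sub>M b\<in>Basis. lborel) borel"
    by measurable
  have m: "(\<lambda>x. \<Prod>b\<in>Basis. f b (x \<bullet> b)) \<in> borel_measurable borel"
    by measurable
  have *: "(\<Prod>b\<in>Basis. f b (?T y \<bullet> b)) = (\<Prod>b\<in>Basis. f b (y b))" for y
    by (intro prod.cong) auto
  have int: "integrable (\<Pi>\<^sub>M b\<in>Basis. lborel) (\<lambda>y. \<Prod>b\<in>Basis. f b (y b))"
    by (intro P.product_integrable_prod assms) auto
  show "integrable lborel (\<lambda>x. \<Prod>b\<in>Basis. f b (x \<bullet> b))"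
    unfolding lborel_eq[where 'a='b] by (subst integrable_distr_eq[OF T m]) (simp only: * int)
  show "(CLINT x|lborel. (\<Prod>b\<in>Basis. f b (x \<bullet> b))) = (\<Prod>b\<in>Basis. CLINT x|lborel. f b x)"
    unfolding lborel_eq[where 'a='b]
    by (subst integral_distr[OF T m]) (simp only: * P.product_integral_prod assms finite_Basis)
qed

text \<open>Density and character both factor over the coordinates, leaving one-dimensional Gaussian
  integrals. Integrability is recorded too, because the case \<open>t = 0\<close> later gives the
  total mass of the law.\<close>

lemma char_std_normal_vec_aux:
  fixes t :: "real^'d"
  shows "integrable lborel (\<lambda>x. (exp (- (norm x)\<^sup>2 / 2) / sqrt (2 * pi) ^ CARD('d)) *\<^sub>R iexp (t \<bullet> x))"
    and "(CLINT x|lborel. (exp (- (norm x)\<^sup>2 / 2) / sqrt (2 * pi) ^ CARD('d)) *\<^sub>R iexp (t \<bullet> x)) =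
      exp (- (norm t)\<^sup>2 / 2)"
proof -
  let ?f = "\<lambda>(b::real^'d) u. std_normal_density u *\<^sub>R iexp ((t \<bullet> b) * u)"
  have eq: "(exp (- (norm x)\<^sup>2 / 2) / sqrt (2 * pi) ^ CARD('d)) *\<^sub>R iexp (t \<bullet> x) = (\<Prod>b\<in>Basis. ?f b (x \<bullet> b))" for x
  proof -
    have "iexp (t \<bullet> x) = (\<Prod>b\<in>Basis. iexp ((t \<bullet> b) * (x \<bullet> b)))"
      by (subst euclidean_inner) (simp add: exp_sum sum_distrib_left)
    then show ?thesis
      unfolding std_normal_vec_density by (simp add: scaleR_conv_of_real prod.distrib)
  qed
  have int: "integrable lborel (?f b)" for b
    by (rule Bochner_Integration.integrable_bound[OF integrable_std_normal_moment[of 0]])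
       (auto simp: norm_mult)
  have char: "(CLINT u|lborel. ?f b u) = exp (- (t \<bullet> b)\<^sup>2 / 2)" for b
  proof -
    have "char std_normal_distribution (t \<bullet> b) = (CLINT u|lborel. ?f b u)"
      unfolding char_def by (subst integral_density) auto
    then show ?thesis
      by (simp add: char_std_normal_distribution)
  qed
  show "integrable lborel (\<lambda>x. (exp (- (norm x)\<^sup>2 / 2) / sqrt (2 * pi) ^ CARD('d)) *\<^sub>R iexp (t \<bullet> x))"
    unfolding eq by (intro integral_lborel_prod int)
  have "(norm t)\<^sup>2 = (\<Sum>b\<in>Basis. (t \<bullet> b)\<^sup>2)"
    unfolding power2_norm_eq_inner by (subst euclidean_inner) (simp add: power2_eq_square)
  then show "(CLINT x|lborel. (exp (- (norm x)\<^sup>2 / 2) / sqrt (2 * pi) ^ CARD('d)) *\<^sub>R iexp (t \<bullet> x)) =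
      exp (- (norm t)\<^sup>2 / 2)"
    unfolding eq integral_lborel_prod(2)[OF int] char
    by (simp add: exp_sum[symmetric] sum_negf sum_divide_distrib flip: of_real_prod)
qed

lemma sets_std_normal_vec: "sets std_normal_vec = sets borel"
  by (simp add: std_normal_vec_def)

lemma prob_space_std_normal_vec: "prob_space (std_normal_vec :: (real^'d) measure)"
proof
  let ?g = "\<lambda>x::real^'d. exp (- (norm x)\<^sup>2 / 2) / sqrt (2 * pi) ^ CARD('d)"
  have 1: "integrable lborel (\<lambda>x. complex_of_real (?g x))" "(CLINT x|lborel. complex_of_real (?g x)) = 1"
    using char_std_normal_vec_aux[of "0::real^'d"] by (simp_all add: scaleR_conv_of_real)
  have "integrable lborel ?g" "integral\<^sup>L lborel ?g = 1"
    using 1 by (simp_all only: complex_of_real_integrable_eq integral_complex_of_real of_real_eq_1_iff)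
  then have "(\<integral>\<^sup>+x. ennreal (?g x) \<partial>lborel) = 1"
    by (subst nn_integral_eq_integral) auto
  then show "emeasure (std_normal_vec :: (real^'d) measure) (space std_normal_vec) = 1"
    by (simp add: std_normal_vec_def emeasure_density)
qed

lemma char_std_normal_vec:
  "(CLINT x|std_normal_vec. iexp (t \<bullet> (x::real^'d))) = exp (- (norm t)\<^sup>2 / 2)"
  unfolding std_normal_vec_def
  using char_std_normal_vec_aux(2)[of t] by (subst integral_density) auto

section \<open>Sums of independent random variables\<close>

text \<open>After expanding the square, independence factors the mixed expectations into products of
  zero means.\<close>

lemma (in prob_space) expectation_sum_power2_indep:
  fixes X :: "'i \<Rightarrow> 'a \<Rightarrow> real"
  assumes I: "finite I" and indep: "indep_vars (\<lambda>_. borel) X I"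
    and sq: "\<And>i. i \<in> I \<Longrightarrow> integrable M (\<lambda>\<omega>. (X i \<omega>)\<^sup>2)"
    and mean: "\<And>i. i \<in> I \<Longrightarrow> expectation (X i) = 0"
  shows "integrable M (\<lambda>\<omega>. (\<Sum>i\<in>I. X i \<omega>)\<^sup>2)"
    and "expectation (\<lambda>\<omega>. (\<Sum>i\<in>I. X i \<omega>)\<^sup>2) = (\<Sum>i\<in>I. expectation (\<lambda>\<omega>. (X i \<omega>)\<^sup>2))"
proof -
  have m: "X i \<in> borel_measurable M" if "i \<in> I" for i
    using indep that by (simp add: indep_vars_def2)
  have int: "integrable M (X i)" if "i \<in> I" for i
    using m[OF that] sq[OF that] by (rule square_integrable_imp_integrable)
  have prod: "integrable M (\<lambda>\<omega>. X i \<omega> * X j \<omega>)"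
    "expectation (\<lambda>\<omega>. X i \<omega> * X j \<omega>) = (if i = j then expectation (\<lambda>\<omega>. (X i \<omega>)\<^sup>2) else 0)"
    if ij: "i \<in> I" "j \<in> I" for i j
  proof -
    have "integrable M (\<lambda>\<omega>. X i \<omega> * X j \<omega>) \<and> expectation (\<lambda>\<omega>. X i \<omega> * X j \<omega>) = 0" if "i \<noteq> j"
    proof -
      have "indep_vars (\<lambda>_. borel) X {i, j}"
        using indep ij by (rule_tac indep_vars_subset) auto
      from indep_vars_integrable[OF _ this] indep_vars_lebesgue_integral[OF _ this]
      show ?thesis using that int ij mean by auto
    qed
    then show "integrable M (\<lambda>\<omega>. X i \<omega> * X j \<omega>)"
      "expectation (\<lambda>\<omega>. X i \<omega> * X j \<omega>) = (if i = j then expectation (\<lambda>\<omega>. (X i \<omega>)\<^sup>2) else 0)"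
      using sq[OF ij(1)] by (cases "i = j"; simp add: power2_eq_square)+
  qed
  have eq: "(\<Sum>i\<in>I. X i \<omega>)\<^sup>2 = (\<Sum>i\<in>I. \<Sum>j\<in>I. X i \<omega> * X j \<omega>)" for \<omega>
    by (simp add: power2_eq_square sum_product)
  show "integrable M (\<lambda>\<omega>. (\<Sum>i\<in>I. X i \<omega>)\<^sup>2)"
    unfolding eq by (intro Bochner_Integration.integrable_sum prod)
  have "expectation (\<lambda>\<omega>. (\<Sum>i\<in>I. X i \<omega>)\<^sup>2) = (\<Sum>i\<in>I. \<Sum>j\<in>I. expectation (\<lambda>\<omega>. X i \<omega> * X j \<omega>))"
    unfolding eq
    by (simp add: Bochner_Integration.integral_sum Bochner_Integration.integrable_sum prod(1))
  also have "\<dots> = (\<Sum>i\<in>I. expectation (\<lambda>\<omega>. (X i \<omega>)\<^sup>2))"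
    using I by (simp add: prod(2))
  finally show "expectation (\<lambda>\<omega>. (\<Sum>i\<in>I. X i \<omega>)\<^sup>2) = (\<Sum>i\<in>I. expectation (\<lambda>\<omega>. (X i \<omega>)\<^sup>2))" .
qed

text \<open>Nonnegativity of the variance of the absolute value.\<close>

lemma (in prob_space) expectation_abs_le_sqrt:
  fixes Y :: "'a \<Rightarrow> real"
  assumes m: "Y \<in> borel_measurable M" and sq: "integrable M (\<lambda>\<omega>. (Y \<omega>)\<^sup>2)"
  shows "expectation (\<lambda>\<omega>. \<bar>Y \<omega>\<bar>) \<le> sqrt (expectation (\<lambda>\<omega>. (Y \<omega>)\<^sup>2))"
proof -
  have "integrable M Y"
    using m sq by (rule square_integrable_imp_integrable)
  then have "0 \<le> expectation (\<lambda>\<omega>. (Y \<omega>)\<^sup>2) - (expectation (\<lambda>\<omega>. \<bar>Y \<omega>\<bar>))\<^sup>2"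
    using variance_positive[of "\<lambda>\<omega>. \<bar>Y \<omega>\<bar>"] variance_eq[of "\<lambda>\<omega>. \<bar>Y \<omega>\<bar>"] sq by simp
  then show ?thesis
    by (intro real_le_rsqrt) simp
qed

text \<open>A law of large numbers in mean from first moments only. The truncated and centred
  summands \<open>W i\<close> have variance at most \<delta> times the first absolute moment of
  \<open>U i\<close>; the part above \<delta> counts twice, once itself and once through its
  mean.\<close>

lemma (in prob_space) expectation_abs_sum_deviation_le:
  fixes U :: "'i \<Rightarrow> 'a \<Rightarrow> real"
  assumes I: "finite I" and indep: "indep_vars (\<lambda>_. borel) U I"
    and int: "\<And>i. i \<in> I \<Longrightarrow> integrable M (U i)" and \<delta>: "\<delta> > 0"
  shows "expectation (\<lambda>\<omega>. \<bar>(\<Sum>i\<in>I. U i \<omega>) - (\<Sum>i\<in>I. expectation (U i))\<bar>) \<le>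
      sqrt (\<delta> * (\<Sum>i\<in>I. expectation (\<lambda>\<omega>. \<bar>U i \<omega>\<bar>))) +
      2 * (\<Sum>i\<in>I. expectation (\<lambda>\<omega>. \<bar>U i \<omega>\<bar> * indicator {\<omega>. \<bar>U i \<omega>\<bar> \<ge> \<delta>} \<omega>))"
proof -
  have m [measurable]: "U i \<in> borel_measurable M" if "i \<in> I" for i
    using indep that by (simp add: indep_vars_def2)
  define T where "T u = (if \<bar>u\<bar> < \<delta> then u else 0)" for u :: real
  have T [measurable]: "T \<in> borel_measurable borel"
    unfolding T_def by measurable
  define D where "D i \<omega> = \<bar>U i \<omega>\<bar> * indicator {\<omega>. \<bar>U i \<omega>\<bar> \<ge> \<delta>} \<omega>" for i \<omega>
  have UT: "\<bar>U i \<omega> - T (U i \<omega>)\<bar> = D i \<omega>" for i \<omega>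
    by (auto simp: T_def D_def indicator_def)
  have D: "integrable M (D i)" if i: "i \<in> I" for i
  proof (rule Bochner_Integration.integrable_bound[OF int[OF i]])
    show "D i \<in> borel_measurable M"
      using i unfolding UT[symmetric] by measurable
  qed (auto simp: D_def indicator_def)
  have V: "integrable M (\<lambda>\<omega>. T (U i \<omega>))" if i: "i \<in> I" for i
    using i \<delta> by (intro integrable_const_bound[of _ \<delta>]) (auto simp: T_def)
  have V2: "integrable M (\<lambda>\<omega>. (T (U i \<omega>))\<^sup>2)" if i: "i \<in> I" for i
    using i \<delta> by (intro integrable_const_bound[of _ "\<delta>\<^sup>2"])
      (auto simp: T_def intro!: power_mono abs_le_square_iff[THEN iffD1])
  define W where "W i \<omega> = T (U i \<omega>) - expectation (\<lambda>\<omega>. T (U i \<omega>))" for i \<omega>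
  have indepW: "indep_vars (\<lambda>_. borel) W I"
    unfolding W_def by (rule indep_vars_compose2[OF indep]) measurable
  have Wm [measurable]: "W i \<in> borel_measurable M" if "i \<in> I" for i
    using indepW that by (simp add: indep_vars_def2)
  have W2: "integrable M (\<lambda>\<omega>. (W i \<omega>)\<^sup>2)"
    and W0: "expectation (W i) = 0" if i: "i \<in> I" for i
    using V[OF i] V2[OF i] unfolding W_def by (simp_all add: power2_diff prob_space)
  have EW: "expectation (\<lambda>\<omega>. (W i \<omega>)\<^sup>2) \<le> \<delta> * expectation (\<lambda>\<omega>. \<bar>U i \<omega>\<bar>)" if i: "i \<in> I" for i
  proof -
    have "expectation (\<lambda>\<omega>. (W i \<omega>)\<^sup>2) = expectation (\<lambda>\<omega>. (T (U i \<omega>))\<^sup>2) - (expectation (\<lambda>\<omega>. T (U i \<omega>)))\<^sup>2"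
      unfolding W_def by (rule variance_eq[OF V[OF i] V2[OF i]])
    also have "\<dots> \<le> expectation (\<lambda>\<omega>. (T (U i \<omega>))\<^sup>2)" by simp
    also have "\<dots> \<le> expectation (\<lambda>\<omega>. \<delta> * \<bar>U i \<omega>\<bar>)"
    proof (intro integral_mono V2 i)
      show "(T (U i \<omega>))\<^sup>2 \<le> \<delta> * \<bar>U i \<omega>\<bar>" for \<omega>
        using \<delta> mult_right_mono[of "\<bar>U i \<omega>\<bar>" \<delta> "\<bar>U i \<omega>\<bar>"] by (auto simp: T_def power2_eq_square)
    qed (use int[OF i] in auto)
    finally show ?thesis by simp
  qed
  have sumW: "expectation (\<lambda>\<omega>. \<bar>\<Sum>i\<in>I. W i \<omega>\<bar>) \<le> sqrt (\<delta> * (\<Sum>i\<in>I. expectation (\<lambda>\<omega>. \<bar>U i \<omega>\<bar>)))"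
  proof -
    note * = expectation_sum_power2_indep[OF I indepW W2 W0]
    have "expectation (\<lambda>\<omega>. \<bar>\<Sum>i\<in>I. W i \<omega>\<bar>) \<le> sqrt (expectation (\<lambda>\<omega>. (\<Sum>i\<in>I. W i \<omega>)\<^sup>2))"
      by (rule expectation_abs_le_sqrt) (auto intro: *)
    also have "\<dots> \<le> sqrt (\<Sum>i\<in>I. \<delta> * expectation (\<lambda>\<omega>. \<bar>U i \<omega>\<bar>))"
      by (subst *(2)) (auto intro!: sum_mono EW)
    finally show ?thesis by (simp add: sum_distrib_left)
  qed
  have intW: "integrable M (W i)" if "i \<in> I" for i
    using Wm[OF that] W2[OF that] by (rule square_integrable_imp_integrable)
  have le: "\<bar>(\<Sum>i\<in>I. U i \<omega>) - (\<Sum>i\<in>I. expectation (U i))\<bar> \<le>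
      \<bar>\<Sum>i\<in>I. W i \<omega>\<bar> + ((\<Sum>i\<in>I. D i \<omega>) + (\<Sum>i\<in>I. expectation (D i)))" for \<omega>
  proof -
    have "(\<Sum>i\<in>I. U i \<omega>) - (\<Sum>i\<in>I. expectation (U i)) =
        (\<Sum>i\<in>I. W i \<omega>) + ((\<Sum>i\<in>I. U i \<omega> - T (U i \<omega>)) - (\<Sum>i\<in>I. expectation (\<lambda>\<omega>. U i \<omega> - T (U i \<omega>))))"
      using int V by (simp add: W_def sum_subtractf cong: sum.cong)
    moreover have "\<bar>\<Sum>i\<in>I. U i \<omega> - T (U i \<omega>)\<bar> \<le> (\<Sum>i\<in>I. D i \<omega>)"
      using sum_abs[of "\<lambda>i. U i \<omega> - T (U i \<omega>)" I] by (simp add: UT)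
    moreover have "\<bar>\<Sum>i\<in>I. expectation (\<lambda>\<omega>. U i \<omega> - T (U i \<omega>))\<bar> \<le> (\<Sum>i\<in>I. expectation (D i))"
    proof (rule order_trans[OF sum_abs sum_mono])
      show "\<bar>expectation (\<lambda>\<omega>. U i \<omega> - T (U i \<omega>))\<bar> \<le> expectation (D i)" for i
        using integral_abs_bound[of M "\<lambda>\<omega>. U i \<omega> - T (U i \<omega>)"] by (simp add: UT)
    qed
    ultimately show ?thesis by linarith
  qed
  have "expectation (\<lambda>\<omega>. \<bar>(\<Sum>i\<in>I. U i \<omega>) - (\<Sum>i\<in>I. expectation (U i))\<bar>) \<le>
      expectation (\<lambda>\<omega>. \<bar>\<Sum>i\<in>I. W i \<omega>\<bar> + ((\<Sum>i\<in>I. D i \<omega>) + (\<Sum>i\<in>I. expectation (D i))))"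
    using le int intW D
    by (intro integral_mono integrable_abs Bochner_Integration.integrable_add
        Bochner_Integration.integrable_diff Bochner_Integration.integrable_sum) auto
  also have "\<dots> = expectation (\<lambda>\<omega>. \<bar>\<Sum>i\<in>I. W i \<omega>\<bar>) + 2 * (\<Sum>i\<in>I. expectation (D i))"
    using intW D by (simp add: Bochner_Integration.integral_add Bochner_Integration.integral_sum prob_space)
  finally show ?thesis
    using sumW by (simp add: D_def[abs_def])
qed

text \<open>\<open>exp (- x)\<close> lies between \<open>1 - x\<close> and
  \<open>1 / (1 + x)\<close>, and the latter is at most \<open>1 - x + x\<^sup>2\<close> because
  \<open>(1 - x + x\<^sup>2) * (1 + x) = 1 + x ^ 3\<close>.\<close>

lemma exp_minus_quadratic_bound:
  fixes x :: real
  assumes "x \<ge> 0"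
  shows "\<bar>1 - x - exp (- x)\<bar> \<le> x\<^sup>2"
proof -
  have "exp (- x) \<ge> 1 - x"
    using exp_ge_add_one_self[of "- x"] by simp
  moreover have "exp (- x) \<le> 1 / (1 + x)"
    using exp_ge_add_one_self[of x] assms by (simp add: exp_minus inverse_eq_divide frac_le)
  moreover have "1 / (1 + x) \<le> 1 - x + x\<^sup>2"
  proof -
    have "1 + x ^ 3 = (1 - x + x\<^sup>2) * (1 + x)"
      by (simp add: algebra_simps power2_eq_square power3_eq_cube)
    then show ?thesis
      using assms by (simp add: divide_le_eq) (smt (verit) zero_le_power)
  qed
  ultimately show ?thesis by (simp add: abs_le_iff)
qed

text \<open>Comparison with Gaussian factors of the same variances. All factors have modulus at most
  1, so the products differ by at most the sum of the factorwise differences, and each factor is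
  compared with \<open>1 - v i / 2\<close>. The argument of the characteristic function is absorbed
  into \<open>X\<close>.\<close>

lemma (in prob_space) char_sum_lindeberg_bound:
  fixes X :: "'i \<Rightarrow> 'a \<Rightarrow> real"
  assumes I: "finite I" and indep: "indep_vars (\<lambda>_. borel) X I"
    and sq: "\<And>i. i \<in> I \<Longrightarrow> integrable M (\<lambda>\<omega>. (X i \<omega>)\<^sup>2)"
    and mean: "\<And>i. i \<in> I \<Longrightarrow> expectation (X i) = 0" and \<mu>: "\<mu> > 0"
  defines "s \<equiv> \<Sum>i\<in>I. expectation (\<lambda>\<omega>. (X i \<omega>)\<^sup>2)"
    and "L \<equiv> \<Sum>i\<in>I. expectation (\<lambda>\<omega>. (X i \<omega>)\<^sup>2 * indicator {\<omega>. \<bar>X i \<omega>\<bar> \<ge> \<mu>} \<omega>)"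
  shows "cmod ((CLINT \<omega>|M. iexp (\<Sum>i\<in>I. X i \<omega>)) - exp (- s / 2)) \<le> \<mu> * s / 6 + L + (\<mu>\<^sup>2 + L) * s"
proof -
  have m [measurable]: "X i \<in> borel_measurable M" if "i \<in> I" for i
    using indep that by (simp add: indep_vars_def2)
  have int: "integrable M (X i)" if "i \<in> I" for i
    using m[OF that] sq[OF that] by (rule square_integrable_imp_integrable)
  define v where "v i = expectation (\<lambda>\<omega>. (X i \<omega>)\<^sup>2)" for i
  define D where "D i \<omega> = (X i \<omega>)\<^sup>2 * indicator {\<omega>. \<bar>X i \<omega>\<bar> \<ge> \<mu>} \<omega>" for i \<omega>
  define \<phi> where "\<phi> i = char (distr M borel (X i)) 1" for i
  have s: "s = (\<Sum>i\<in>I. v i)" and L: "L = (\<Sum>i\<in>I. expectation (D i))"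
    by (simp_all add: s_def v_def L_def D_def[abs_def])
  have v0: "v i \<ge> 0" for i by (simp add: v_def)
  have D0: "expectation (D i) \<ge> 0" for i by (simp add: D_def)
  have D: "integrable M (D i)" if i: "i \<in> I" for i
  proof (rule Bochner_Integration.integrable_bound[OF sq[OF i]])
    have "D i = (\<lambda>\<omega>. if \<bar>X i \<omega>\<bar> \<ge> \<mu> then (X i \<omega>)\<^sup>2 else 0)"
      by (auto simp: D_def)
    then show "D i \<in> borel_measurable M"
      using i by simp
  qed (auto simp: D_def indicator_def)
  have char_eq: "(CLINT \<omega>|M. iexp (\<Sum>i\<in>I. X i \<omega>)) = (\<Prod>i\<in>I. \<phi> i)"
  proof -
    have "(CLINT \<omega>|M. iexp (\<Sum>i\<in>I. X i \<omega>)) = char (distr M borel (\<lambda>\<omega>. \<Sum>i\<in>I. X i \<omega>)) 1"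
      unfolding char_def by (subst integral_distr) auto
    also have "\<dots> = (\<Prod>i\<in>I. \<phi> i)"
      unfolding \<phi>_def by (rule char_distr_sum[OF indep])
    finally show ?thesis .
  qed
  have exp_eq: "complex_of_real (exp (- s / 2)) = (\<Prod>i\<in>I. complex_of_real (exp (- v i / 2)))"
    by (simp add: s exp_sum[OF I, symmetric] sum_negf sum_divide_distrib flip: of_real_prod)
  have \<phi>_le: "cmod (\<phi> i - complex_of_real (exp (- v i / 2))) \<le>
      \<mu> * v i / 6 + expectation (D i) + (\<mu>\<^sup>2 + L) * v i" if i: "i \<in> I" for i
  proof -
    \<comment> \<open>The minimum makes second moments sufficient: below \<mu> the cubic term is at
      most \<mu> times the square, and above \<mu> the quadratic term is used.\<close>
    have "cmod (\<phi> i - (1 - 1\<^sup>2 * v i / 2)) \<le>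
        1\<^sup>2 / 6 * expectation (\<lambda>\<omega>. min (6 * (X i \<omega>)\<^sup>2) (\<bar>1\<bar> * \<bar>X i \<omega>\<bar> ^ 3))"
      unfolding \<phi>_def
      by (rule char_approx3') (auto simp: i int sq mean v_def)
    also have "\<dots> \<le> 1\<^sup>2 / 6 * expectation (\<lambda>\<omega>. \<mu> * (X i \<omega>)\<^sup>2 + 6 * D i \<omega>)"
    proof (intro mult_left_mono integral_mono)
      show "integrable M (\<lambda>\<omega>. min (6 * (X i \<omega>)\<^sup>2) (\<bar>1\<bar> * \<bar>X i \<omega>\<bar> ^ 3))"
        using i by (intro Bochner_Integration.integrable_bound[OF integrable_mult_right[OF sq[OF i], of 6]])
          (auto simp: abs_le_iff)
      show "integrable M (\<lambda>\<omega>. \<mu> * (X i \<omega>)\<^sup>2 + 6 * D i \<omega>)"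
        using sq D i by simp
      fix \<omega>
      show "min (6 * (X i \<omega>)\<^sup>2) (\<bar>1\<bar> * \<bar>X i \<omega>\<bar> ^ 3) \<le> \<mu> * (X i \<omega>)\<^sup>2 + 6 * D i \<omega>"
      proof (cases "\<bar>X i \<omega>\<bar> \<ge> \<mu>")
        case True
        then show ?thesis using \<mu> by (simp add: D_def min_le_iff_disj)
      next
        case False
        then have "\<bar>X i \<omega>\<bar> * \<bar>X i \<omega>\<bar>\<^sup>2 \<le> \<mu> * \<bar>X i \<omega>\<bar>\<^sup>2"
          by (intro mult_right_mono) auto
        then show ?thesis
          using False by (simp add: D_def min_le_iff_disj power3_eq_cube power2_eq_square mult.commute mult.left_commute)
      qed
    qed auto
    also have "\<dots> = \<mu> * v i / 6 + expectation (D i)"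
      using sq D i by (simp add: v_def)
    finally have 1: "cmod (\<phi> i - (1 - v i / 2)) \<le> \<mu> * v i / 6 + expectation (D i)"
      by simp
    \<comment> \<open>No single variance exceeds \<open>\<mu>\<^sup>2 + L\<close>; the quadratic
      error \<open>v i * v i\<close> of the exponential thus becomes linear in \<open>v i\<close>
      and sums to a multiple of \<open>s\<close>.\<close>
    have "v i \<le> expectation (\<lambda>\<omega>. \<mu>\<^sup>2 + D i \<omega>)"
      unfolding v_def
    proof (intro integral_mono sq i)
      show "integrable M (\<lambda>\<omega>. \<mu>\<^sup>2 + D i \<omega>)" using D i by simp
      show "(X i \<omega>)\<^sup>2 \<le> \<mu>\<^sup>2 + D i \<omega>" for \<omega>
        using \<mu> by (cases "\<bar>X i \<omega>\<bar> \<ge> \<mu>") (auto simp: D_def intro!: abs_le_square_iff[THEN iffD1])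
    qed
    also have "\<dots> = \<mu>\<^sup>2 + expectation (D i)"
      using D i by (simp add: prob_space)
    also have "\<dots> \<le> \<mu>\<^sup>2 + L"
      unfolding L using i I D0 by (intro add_left_mono member_le_sum) auto
    finally have "v i * v i \<le> (\<mu>\<^sup>2 + L) * v i"
      using v0 by (rule mult_right_mono)
    moreover have "\<bar>1 - v i / 2 - exp (- v i / 2)\<bar> \<le> (v i / 2)\<^sup>2"
      using exp_minus_quadratic_bound[of "v i / 2"] v0[of i] by simp
    moreover have "(v i / 2)\<^sup>2 \<le> v i * v i"
      by (simp add: power2_eq_square)
    moreover have "cmod ((1 - v i / 2) - complex_of_real (exp (- v i / 2))) = \<bar>1 - v i / 2 - exp (- v i / 2)\<bar>"
      by (subst norm_of_real[symmetric, where 'a=complex]) simp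
    ultimately have 2: "cmod ((1 - v i / 2) - complex_of_real (exp (- v i / 2))) \<le> (\<mu>\<^sup>2 + L) * v i"
      by linarith
    show ?thesis
      using norm_triangle_ineq[of "\<phi> i - (1 - v i / 2)" "(1 - v i / 2) - complex_of_real (exp (- v i / 2))"] 1 2
      by simp
  qed
  have "cmod ((\<Prod>i\<in>I. \<phi> i) - (\<Prod>i\<in>I. complex_of_real (exp (- v i / 2)))) \<le>
      (\<Sum>i\<in>I. cmod (\<phi> i - complex_of_real (exp (- v i / 2))))"
  proof (rule norm_prod_diff)
    show "cmod (\<phi> i) \<le> 1" if "i \<in> I" for i
    proof -
      interpret D: real_distribution "distr M borel (X i)"
        using that by (intro real_distribution_distr) simp
      show ?thesis unfolding \<phi>_def by (rule D.cmod_char_le_1)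
    qed
  qed (use v0 in simp)
  also have "\<dots> \<le> (\<Sum>i\<in>I. \<mu> * v i / 6 + expectation (D i) + (\<mu>\<^sup>2 + L) * v i)"
    by (intro sum_mono \<phi>_le)
  also have "\<dots> = \<mu> * s / 6 + L + (\<mu>\<^sup>2 + L) * s"
    by (simp add: sum.distrib s L sum_distrib_left sum_divide_distrib)
  finally show ?thesis
    unfolding char_eq exp_eq .
qed

text \<open>Limits in succession: for fixed positive \<mu> the bound \<open>h \<mu>\<close> tends to
  \<open>c \<mu>\<close>, and only then does \<mu> decrease to 0. Truncation levels and error
  tolerances below are removed in this way.\<close>

lemma tendsto_zero_iterated:
  fixes a :: "'i \<Rightarrow> real" and h :: "real \<Rightarrow> 'i \<Rightarrow> real"
  assumes "\<And>n. 0 \<le> a n" and le: "\<And>\<mu>. \<mu> > 0 \<Longrightarrow> \<forall>\<^sub>F n in F. a n \<le> h \<mu> n"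
    and h: "\<And>\<mu>. \<mu> > 0 \<Longrightarrow> (h \<mu> \<longlongrightarrow> c \<mu>) F" and c: "(c \<longlongrightarrow> 0) (at_right 0)"
  shows "(a \<longlongrightarrow> 0) F"
proof (rule tendstoI)
  fix e :: real
  assume "e > 0"
  with c have "\<forall>\<^sub>F \<mu> in at_right 0. c \<mu> < e"
    by (rule order_tendstoD)
  then obtain b where b: "b > 0" "\<And>\<mu>. 0 < \<mu> \<Longrightarrow> \<mu> < b \<Longrightarrow> c \<mu> < e"
    unfolding eventually_at_right_field by auto
  then have "\<forall>\<^sub>F n in F. h (b / 2) n < e"
    by (intro order_tendstoD[OF h]) auto
  moreover have "\<forall>\<^sub>F n in F. a n \<le> h (b / 2) n"
    using b(1) by (intro le) simp
  ultimately have "\<forall>\<^sub>F n in F. a n < e"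
    by eventually_elim simp
  then show "\<forall>\<^sub>F n in F. dist (a n) 0 < e"
    using assms(1) by simp
qed

section \<open>Triangular arrays under the Lindeberg condition\<close>

lemma bounded_bilinear_outer: "bounded_bilinear (outer :: real^'d \<Rightarrow> _)"
proof -
  have "bilinear (outer :: real^'d \<Rightarrow> _)"
    by (auto simp: bilinear_def outer_def vec_eq_iff algebra_simps intro!: linearI)
  then show ?thesis
    by (simp add: bilinear_conv_bounded_bilinear)
qed

lemma bounded_bilinear_matrix_vector_mult: "bounded_bilinear ((*v) :: real^'d^'d \<Rightarrow> _)"
proof -
  have "bilinear ((*v) :: real^'d^'d \<Rightarrow> _)"
    by (auto simp: bilinear_def matrix_vector_mult_def vec_eq_iff algebra_simps sum.distrib
        sum_distrib_left intro!: linearI)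
  then show ?thesis
    by (simp add: bilinear_conv_bounded_bilinear)
qed

lemma borel_measurable_outer [measurable]:
  fixes f g :: "'a \<Rightarrow> real^'d"
  assumes "f \<in> borel_measurable M" "g \<in> borel_measurable M"
  shows "(\<lambda>\<omega>. outer (f \<omega>) (g \<omega>)) \<in> borel_measurable M"
  by (rule borel_measurable_continuous_Pair[OF assms])
     (intro bounded_bilinear.continuous_on[OF bounded_bilinear_outer] continuous_intros)

lemma borel_measurable_matrix_vector_mult [measurable]:
  fixes f :: "'a \<Rightarrow> real^'d^'d"
  assumes "f \<in> borel_measurable M" "g \<in> borel_measurable M"
  shows "(\<lambda>\<omega>. f \<omega> *v g \<omega>) \<in> borel_measurable M"
  by (rule borel_measurable_continuous_Pair[OF assms])
     (intro bounded_bilinear.continuous_on[OF bounded_bilinear_matrix_vector_mult] continuous_intros)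

lemma outer_nth [simp]: "outer x y $ j $ k = x $ j * y $ k"
  by (simp add: outer_def)

text \<open>Applied under the integral, this and \<open>trace_outer\<close> turn covariance matrices
  into second moments of \<open>t \<bullet> Z n i \<omega>\<close> and of the norm.\<close>

lemma quadratic_form_outer: "(t v* outer x x) \<bullet> t = (t \<bullet> x)\<^sup>2"
  by (simp add: inner_vec_def vector_matrix_mult_def power2_eq_square sum_distrib_left sum_distrib_right
      algebra_simps)

lemma trace_outer: "trace (outer x x) = (norm x)\<^sup>2"
  by (simp add: trace_def power2_norm_eq_inner inner_vec_def)

lemma norm_outer: "norm (outer x x) = (norm x)\<^sup>2"
proof -
  have *: "(norm (outer x x))\<^sup>2 = ((norm x)\<^sup>2)\<^sup>2"
    unfolding power2_norm_eq_inner
    by (simp add: inner_vec_def power2_eq_square sum_product algebra_simps)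
  show ?thesis
    by (rule power2_eq_imp_eq[OF *]) auto
qed

lemma bounded_linear_trace: "bounded_linear (trace :: real^'d^'d \<Rightarrow> real)"
  by (auto simp: trace_def sum.distrib sum_distrib_left linear_conv_bounded_linear[symmetric] intro!: linearI)

lemma bounded_linear_quadratic_form: "bounded_linear (\<lambda>A :: real^'d^'d. (t v* A) \<bullet> t)"
  by (auto simp: linear_conv_bounded_linear[symmetric] vector_matrix_mult_add_rdistrib
      vector_scaleR_matrix_ac inner_add_left intro!: linearI)

lemma norm_matrix_le_sum_abs: "norm (A :: real^'d^'d) \<le> (\<Sum>j\<in>UNIV. \<Sum>k\<in>UNIV. \<bar>A $ j $ k\<bar>)"
proof -
  have "norm A \<le> (\<Sum>j\<in>UNIV. norm (A $ j))"
    unfolding norm_vec_def[of A] by (rule L2_set_le_sum) simp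
  also have "\<dots> \<le> (\<Sum>j\<in>UNIV. \<Sum>k\<in>UNIV. \<bar>A $ j $ k\<bar>)"
    by (intro sum_mono norm_le_l1_cart)
  finally show ?thesis .
qed

text \<open>The usual removal of the mean from a sum of squares. For \<open>n = 1\<close> both sides
  vanish by division by zero.\<close>

lemma sample_cov_eq:
  fixes z :: "nat \<Rightarrow> real^'d"
  assumes "n \<ge> 1"
  shows "real n *\<^sub>R sample_cov n z = (real n / (real n - 1)) *\<^sub>R
    ((\<Sum>i=1..n. outer (z i) (z i)) - (1 / real n) *\<^sub>R outer (\<Sum>i=1..n. z i) (\<Sum>i=1..n. z i))"
proof -
  have "(\<Sum>i=1..n. (z i $ j - S $ j / n) * (z i $ k - S $ k / n)) =
      (\<Sum>i=1..n. z i $ j * z i $ k) - S $ j * S $ k / n"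
    if S: "S = (\<Sum>i=1..n. z i)" for S j k
  proof -
    have expand: "(\<Sum>i=1..n. (z i $ j - S $ j / n) * (z i $ k - S $ k / n)) =
        (\<Sum>i=1..n. z i $ j * z i $ k) - (\<Sum>i=1..n. z i $ j) * (S $ k / n)
        - (S $ j / n) * (\<Sum>i=1..n. z i $ k) + real n * ((S $ j / n) * (S $ k / n))"
      by (simp add: algebra_simps sum.distrib sum_subtractf sum_distrib_left sum_distrib_right sum_divide_distrib)
    have sums: "(\<Sum>i=1..n. z i $ l) = S $ l" for l
      by (simp add: S)
    show ?thesis
      unfolding expand sums using assms by (simp add: field_simps)
  qed
  from this[OF refl] show ?thesis
    by (simp add: sample_cov_def sample_mean_def vec_eq_iff)
qed

text \<open>A relatively open subset of a closed subspace is Borel.\<close>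

lemma sets_pos_def: "{A :: real^'d^'d. pos_def A} \<in> sets borel"
proof -
  obtain T :: "(real^'d^'d) set" where T: "open T" "{A. pos_def A} = {A. transpose A = A} \<inter> T"
    using openin_pos_def unfolding openin_open by auto
  show ?thesis
    unfolding T(2) by (intro sets.Int borel_open[OF T(1)] borel_closed closed_subspace subspace_symmetric)
qed

locale lindeberg_array =
  fixes M :: "nat \<Rightarrow> 'a measure"
    and Z :: "nat \<Rightarrow> nat \<Rightarrow> 'a \<Rightarrow> real^'d"
    and \<Sigma> :: "real^'d^'d"
  assumes prob: "\<And>n. n \<ge> 1 \<Longrightarrow> prob_space (M n)"
    and indep: "\<And>n. n \<ge> 1 \<Longrightarrow> prob_space.indep_vars (M n) (\<lambda>_. borel) (Z n) {1..n}"
    and integrable: "\<And>n i. 1 \<le> i \<Longrightarrow> i \<le> n \<Longrightarrow> integrable (M n) (Z n i)"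
    and mean_zero: "\<And>n i. 1 \<le> i \<Longrightarrow> i \<le> n \<Longrightarrow> integral\<^sup>L (M n) (Z n i) = 0"
    and cov_finite: "\<And>n i. 1 \<le> i \<Longrightarrow> i \<le> n \<Longrightarrow> cov_finite (M n) (Z n i)"
    and cov_lim: "(\<lambda>n. \<Sum>i=1..n. cov_matrix (M n) (Z n i)) \<longlonglongrightarrow> \<Sigma>"
    and lindeberg: "\<And>\<mu>::real. \<mu> > 0 \<Longrightarrow>
      (\<lambda>n. \<Sum>i=1..n. integral\<^sup>L (M n)
        (\<lambda>\<omega>. (norm (Z n i \<omega>))\<^sup>2 * indicator {\<omega>. norm (Z n i \<omega>) \<ge> \<mu>} \<omega>)) \<longlonglongrightarrow> 0"
begin

definition S where "S n \<omega> = (\<Sum>i=1..n. Z n i \<omega>)"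
definition Q where "Q n \<omega> = (\<Sum>i=1..n. outer (Z n i \<omega>) (Z n i \<omega>))"
definition C where "C n = (\<Sum>i=1..n. cov_matrix (M n) (Z n i))"
text \<open>\<open>sample_cov\<close> is an average, whereas it is the sum of the covariances that
  converges; the factor \<open>n\<close> makes \<Sigma> the limit.\<close>

definition A where "A n \<omega> = real n *\<^sub>R sample_cov n (\<lambda>i. Z n i \<omega>)"
definition Lf where "Lf \<mu> n = (\<Sum>i=1..n. integral\<^sup>L (M n)
        (\<lambda>\<omega>. (norm (Z n i \<omega>))\<^sup>2 * indicator {\<omega>. norm (Z n i \<omega>) \<ge> \<mu>} \<omega>))"

lemma C_tendsto: "C \<longlonglongrightarrow> \<Sigma>"
  using cov_lim by (simp add: C_def[abs_def])

lemma trace_C_tendsto: "(\<lambda>n. trace (C n)) \<longlonglongrightarrow> trace \<Sigma>"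
  by (rule bounded_linear.tendsto[OF bounded_linear_trace C_tendsto])

lemma Lf_tendsto: "\<mu> > 0 \<Longrightarrow> Lf \<mu> \<longlonglongrightarrow> 0"
  using lindeberg by (simp add: Lf_def[abs_def])

context
  fixes n :: nat
  assumes n: "n \<ge> 1"
begin

interpretation prob_space "M n"
  using n by (rule prob)

lemma Z_measurable [measurable]: "i \<in> {1..n} \<Longrightarrow> Z n i \<in> borel_measurable (M n)"
  using integrable[of i n] by (auto dest: borel_measurable_integrable)

lemma S_measurable [measurable]: "S n \<in> borel_measurable (M n)"
  unfolding S_def[abs_def] by measurable

lemma A_measurable [measurable]: "A n \<in> borel_measurable (M n)"
  unfolding A_def[abs_def] sample_cov_def sample_mean_def by measurable

lemma
  assumes i: "i \<in> {1..n}"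
  shows integrable_outer: "integrable (M n) (\<lambda>\<omega>. outer (Z n i \<omega>) (Z n i \<omega>))"
    and cov_matrix_eq: "cov_matrix (M n) (Z n i) = (\<integral>\<omega>. outer (Z n i \<omega>) (Z n i \<omega>) \<partial>M n)"
  using cov_finite[of i n] mean_zero[of i n] i by (simp_all add: cov_finite_def cov_matrix_def centred_def)

lemma
  assumes i: "i \<in> {1..n}"
  shows integrable_norm_sq: "integrable (M n) (\<lambda>\<omega>. (norm (Z n i \<omega>))\<^sup>2)"
    and expectation_norm_sq: "(\<integral>\<omega>. (norm (Z n i \<omega>))\<^sup>2 \<partial>M n) = trace (cov_matrix (M n) (Z n i))"
  using integrable_bounded_linear[OF bounded_linear_trace integrable_outer[OF i]]
    integral_bounded_linear[OF bounded_linear_trace integrable_outer[OF i]]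
  by (simp_all add: trace_outer cov_matrix_eq[OF i])

lemma
  assumes i: "i \<in> {1..n}"
  shows integrable_inner_sq: "integrable (M n) (\<lambda>\<omega>. (t \<bullet> Z n i \<omega>)\<^sup>2)"
    and expectation_inner_sq: "(\<integral>\<omega>. (t \<bullet> Z n i \<omega>)\<^sup>2 \<partial>M n) = (t v* cov_matrix (M n) (Z n i)) \<bullet> t"
  using integrable_bounded_linear[OF bounded_linear_quadratic_form integrable_outer[OF i], of t]
    integral_bounded_linear[OF bounded_linear_quadratic_form integrable_outer[OF i], of t]
  by (simp_all add: quadratic_form_outer cov_matrix_eq[OF i])

lemma sum_expectation_norm_sq: "(\<Sum>i=1..n. \<integral>\<omega>. (norm (Z n i \<omega>))\<^sup>2 \<partial>M n) = trace (C n)"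
  by (simp add: expectation_norm_sq C_def linear_sum[OF bounded_linear.linear[OF bounded_linear_trace]])

lemma sum_expectation_inner_sq: "(\<Sum>i=1..n. \<integral>\<omega>. (t \<bullet> Z n i \<omega>)\<^sup>2 \<partial>M n) = (t v* C n) \<bullet> t"
  by (simp add: expectation_inner_sq C_def linear_sum[OF bounded_linear.linear[OF bounded_linear_quadratic_form]])

lemma indep_inner: "indep_vars (\<lambda>_. borel) (\<lambda>i \<omega>. t \<bullet> Z n i \<omega>) {1..n}"
  by (rule indep_vars_compose2[OF indep[OF n]]) simp

lemma expectation_inner: "i \<in> {1..n} \<Longrightarrow> (\<integral>\<omega>. t \<bullet> Z n i \<omega> \<partial>M n) = 0"
  using integrable[of i n] mean_zero[of i n] by simp

lemma
  shows integrable_inner_S_sq: "integrable (M n) (\<lambda>\<omega>. (t \<bullet> S n \<omega>)\<^sup>2)"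
    and expectation_inner_S_sq: "(\<integral>\<omega>. (t \<bullet> S n \<omega>)\<^sup>2 \<partial>M n) = (t v* C n) \<bullet> t"
  using expectation_sum_power2_indep[OF finite_atLeastAtMost indep_inner integrable_inner_sq expectation_inner, of t]
  by (simp_all only: S_def inner_sum_right sum_expectation_inner_sq)

lemma
  shows integrable_norm_S_sq: "integrable (M n) (\<lambda>\<omega>. (norm (S n \<omega>))\<^sup>2)"
    and expectation_norm_S_sq: "(\<integral>\<omega>. (norm (S n \<omega>))\<^sup>2 \<partial>M n) = trace (C n)"
proof -
  have eq: "(norm x)\<^sup>2 = (\<Sum>j\<in>UNIV. (axis j 1 \<bullet> x)\<^sup>2)" for x :: "real^'d"
    unfolding power2_norm_eq_inner inner_axis' by (simp add: inner_vec_def power2_eq_square)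
  have diag: "(axis j 1 v* C n) \<bullet> axis j 1 = C n $ j $ j" for j
    by (simp add: dot_lmul_matrix inner_axis' matrix_vector_mult_basis column_def)
  show "integrable (M n) (\<lambda>\<omega>. (norm (S n \<omega>))\<^sup>2)"
    unfolding eq by (intro Bochner_Integration.integrable_sum integrable_inner_S_sq)
  show "(\<integral>\<omega>. (norm (S n \<omega>))\<^sup>2 \<partial>M n) = trace (C n)"
    unfolding eq
    by (subst Bochner_Integration.integral_sum)
      (simp_all only: integrable_inner_S_sq expectation_inner_S_sq diag trace_def)
qed

lemma prob_norm_S_ge_le:
  assumes "K > 0"
  shows "prob {\<omega> \<in> space (M n). norm (S n \<omega>) \<ge> K} \<le> trace (C n) / K\<^sup>2"
proof -
  have "{\<omega> \<in> space (M n). norm (S n \<omega>) \<ge> K} = {\<omega> \<in> space (M n). (norm (S n \<omega>))\<^sup>2 \<ge> K\<^sup>2}"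
    using assms by (auto simp: abs_le_square_iff[symmetric])
  also have "prob \<dots> \<le> (\<integral>\<omega>. (norm (S n \<omega>))\<^sup>2 \<partial>M n) / K\<^sup>2"
    using assms by (intro integral_Markov_inequality_measure[where A = "{}"] integrable_norm_S_sq) auto
  finally show ?thesis by (simp add: expectation_norm_S_sq)
qed

text \<open>Carries the Lindeberg condition over to a scalar \<open>Y\<close> dominated by the
  squared norm, when the truncation event forces the norm to be large.\<close>

lemma truncated_le:
  assumes i: "i \<in> {1..n}" and Y [measurable]: "Y \<in> borel_measurable (M n)" and "T \<ge> 0"
    and le: "\<And>\<omega>. \<bar>Y \<omega>\<bar> \<le> T * (norm (Z n i \<omega>))\<^sup>2"
    and sub: "\<And>\<omega>. P \<omega> \<Longrightarrow> norm (Z n i \<omega>) \<ge> \<mu>"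
  shows "(\<integral>\<omega>. \<bar>Y \<omega>\<bar> * indicator {\<omega>. P \<omega>} \<omega> \<partial>M n) \<le>
    T * (\<integral>\<omega>. (norm (Z n i \<omega>))\<^sup>2 * indicator {\<omega>. norm (Z n i \<omega>) \<ge> \<mu>} \<omega> \<partial>M n)"
proof -
  have eq: "(\<lambda>\<omega>. (norm (Z n i \<omega>))\<^sup>2 * indicator {\<omega>. norm (Z n i \<omega>) \<ge> \<mu>} \<omega>) =
      (\<lambda>\<omega>. if norm (Z n i \<omega>) \<ge> \<mu> then (norm (Z n i \<omega>))\<^sup>2 else 0)"
    by auto
  have m: "(\<lambda>\<omega>. if norm (Z n i \<omega>) \<ge> \<mu> then (norm (Z n i \<omega>))\<^sup>2 else 0) \<in> borel_measurable (M n)"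
    using i by measurable
  have "integrable (M n) (\<lambda>\<omega>. (norm (Z n i \<omega>))\<^sup>2 * indicator {\<omega>. norm (Z n i \<omega>) \<ge> \<mu>} \<omega>)"
    unfolding eq by (rule Bochner_Integration.integrable_bound[OF integrable_norm_sq[OF i] m]) auto
  then have int: "integrable (M n) (\<lambda>\<omega>. T * ((norm (Z n i \<omega>))\<^sup>2 * indicator {\<omega>. norm (Z n i \<omega>) \<ge> \<mu>} \<omega>))"
    by (rule integrable_mult_right)
  have "(\<integral>\<omega>. \<bar>Y \<omega>\<bar> * indicator {\<omega>. P \<omega>} \<omega> \<partial>M n) \<le>
      (\<integral>\<omega>. T * ((norm (Z n i \<omega>))\<^sup>2 * indicator {\<omega>. norm (Z n i \<omega>) \<ge> \<mu>} \<omega>) \<partial>M n)"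
    using le sub \<open>T \<ge> 0\<close> by (intro integral_mono_AE' int AE_I2) (auto simp: indicator_def)
  then show ?thesis by simp
qed

text \<open>The 1 in \<open>T\<close> keeps it positive for \<open>t = 0\<close>. As
  \<open>\<bar>t \<bullet> z\<bar>\<close> is at most \<open>T * norm z\<close>, exceeding \<mu> in
  the direction \<open>t\<close> forces the norm to reach \<open>\<mu> / T\<close>.\<close>

lemma char_S_bound:
  fixes t :: "real^'d"
  assumes "\<mu> > 0"
  defines "T \<equiv> norm t + 1"
  shows "cmod ((CLINT \<omega>|M n. iexp (t \<bullet> S n \<omega>)) - exp (- ((t v* C n) \<bullet> t) / 2)) \<le>
    \<mu> * ((t v* C n) \<bullet> t) / 6 + T\<^sup>2 * Lf (\<mu> / T) n + (\<mu>\<^sup>2 + T\<^sup>2 * Lf (\<mu> / T) n) * ((t v* C n) \<bullet> t)"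
proof -
  have T: "T > 0" by (simp add: T_def add_nonneg_pos)
  define L where "L = (\<Sum>i=1..n. \<integral>\<omega>. (t \<bullet> Z n i \<omega>)\<^sup>2 * indicator {\<omega>. \<bar>t \<bullet> Z n i \<omega>\<bar> \<ge> \<mu>} \<omega> \<partial>M n)"
  have "cmod ((CLINT \<omega>|M n. iexp (\<Sum>i=1..n. t \<bullet> Z n i \<omega>)) - exp (- (\<Sum>i=1..n. \<integral>\<omega>. (t \<bullet> Z n i \<omega>)\<^sup>2 \<partial>M n) / 2)) \<le>
      \<mu> * (\<Sum>i=1..n. \<integral>\<omega>. (t \<bullet> Z n i \<omega>)\<^sup>2 \<partial>M n) / 6 + L + (\<mu>\<^sup>2 + L) * (\<Sum>i=1..n. \<integral>\<omega>. (t \<bullet> Z n i \<omega>)\<^sup>2 \<partial>M n)"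
    unfolding L_def
    by (rule char_sum_lindeberg_bound[OF finite_atLeastAtMost indep_inner integrable_inner_sq expectation_inner assms(1)])
  then have 1: "cmod ((CLINT \<omega>|M n. iexp (t \<bullet> S n \<omega>)) - exp (- ((t v* C n) \<bullet> t) / 2)) \<le>
      \<mu> * ((t v* C n) \<bullet> t) / 6 + L + (\<mu>\<^sup>2 + L) * ((t v* C n) \<bullet> t)"
    unfolding sum_expectation_inner_sq S_def inner_sum_right .
  have "L \<le> T\<^sup>2 * Lf (\<mu> / T) n"
    unfolding L_def Lf_def sum_distrib_left
  proof (rule sum_mono)
    fix i assume i: "i \<in> {1..n}"
    have tz: "\<bar>t \<bullet> z\<bar> \<le> T * norm z" for z
      using Cauchy_Schwarz_ineq2[of t z] norm_ge_zero[of z] by (simp add: T_def algebra_simps add_increasing)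
    have "\<bar>(t \<bullet> z)\<^sup>2\<bar> \<le> T\<^sup>2 * (norm z)\<^sup>2" for z
      using power_mono[OF tz[of z], of 2] by (simp add: power_mult_distrib)
    moreover have "norm z \<ge> \<mu> / T" if "\<bar>t \<bullet> z\<bar> \<ge> \<mu>" for z
      using tz[of z] that T by (simp add: divide_le_eq mult.commute)
    ultimately show "(\<integral>\<omega>. (t \<bullet> Z n i \<omega>)\<^sup>2 * indicator {\<omega>. \<bar>t \<bullet> Z n i \<omega>\<bar> \<ge> \<mu>} \<omega> \<partial>M n) \<le>
        T\<^sup>2 * (\<integral>\<omega>. (norm (Z n i \<omega>))\<^sup>2 * indicator {\<omega>. norm (Z n i \<omega>) \<ge> \<mu> / T} \<omega> \<partial>M n)"
      using truncated_le[OF i, of "\<lambda>\<omega>. (t \<bullet> Z n i \<omega>)\<^sup>2" "T\<^sup>2" "\<lambda>\<omega>. \<bar>t \<bullet> Z n i \<omega>\<bar> \<ge> \<mu>" "\<mu> / T"] i by simp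
  qed
  moreover have "(t v* C n) \<bullet> t \<ge> 0"
    unfolding sum_expectation_inner_sq[symmetric] by (intro sum_nonneg) simp
  ultimately have "L + (\<mu>\<^sup>2 + L) * ((t v* C n) \<bullet> t) \<le>
      T\<^sup>2 * Lf (\<mu> / T) n + (\<mu>\<^sup>2 + T\<^sup>2 * Lf (\<mu> / T) n) * ((t v* C n) \<bullet> t)"
    by (intro add_mono mult_right_mono) auto
  with 1 show ?thesis by linarith
qed

text \<open>A product of two coordinates is at most the squared norm in modulus, so the first
  absolute moments add up to at most \<open>trace (C n)\<close>, and truncation at \<delta> becomes
  truncation of the norm at \<open>sqrt \<delta>\<close>.\<close>

lemma Q_entry_bound:
  assumes "\<delta> > 0"
  shows "integrable (M n) (\<lambda>\<omega>. \<bar>Q n \<omega> $ j $ k - C n $ j $ k\<bar>)"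
    and "(\<integral>\<omega>. \<bar>Q n \<omega> $ j $ k - C n $ j $ k\<bar> \<partial>M n) \<le> sqrt (\<delta> * trace (C n)) + 2 * Lf (sqrt \<delta>) n"
proof -
  define U where "U i \<omega> = Z n i \<omega> $ j * Z n i \<omega> $ k" for i \<omega>
  have entry: "bounded_linear (\<lambda>B :: real^'d^'d. B $ j $ k)"
    by (intro bounded_linear_compose[OF bounded_linear_vec_nth] bounded_linear_vec_nth)
  have U: "integrable (M n) (U i)" "integral\<^sup>L (M n) (U i) = cov_matrix (M n) (Z n i) $ j $ k"
    if i: "i \<in> {1..n}" for i
    using integrable_bounded_linear[OF entry integrable_outer[OF i]]
      integral_bounded_linear[OF entry integrable_outer[OF i]]
    by (simp_all add: U_def[abs_def] cov_matrix_eq[OF i])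
  have indepU: "indep_vars (\<lambda>_. borel) U {1..n}"
    unfolding U_def by (rule indep_vars_compose2[OF indep[OF n]]) measurable
  have sumU: "(\<Sum>i=1..n. integral\<^sup>L (M n) (U i)) = C n $ j $ k"
    unfolding C_def sum_component by (rule sum.cong[OF refl U(2)])
  have eq: "Q n \<omega> $ j $ k - C n $ j $ k = (\<Sum>i=1..n. U i \<omega>) - (\<Sum>i=1..n. integral\<^sup>L (M n) (U i))" for \<omega>
    unfolding sumU by (simp add: Q_def U_def)
  show "integrable (M n) (\<lambda>\<omega>. \<bar>Q n \<omega> $ j $ k - C n $ j $ k\<bar>)"
    unfolding eq by (intro integrable_abs Bochner_Integration.integrable_diff
      Bochner_Integration.integrable_sum U integrable_const)
  have zz: "\<bar>z $ j * z $ k\<bar> \<le> (norm z)\<^sup>2" for z :: "real^'d"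
    using mult_mono[OF component_le_norm_cart[of z j] component_le_norm_cart[of z k]]
    by (simp add: abs_mult power2_eq_square)
  have "(\<Sum>i=1..n. \<integral>\<omega>. \<bar>U i \<omega>\<bar> \<partial>M n) \<le> trace (C n)"
    unfolding sum_expectation_norm_sq[symmetric]
    by (intro sum_mono integral_mono integrable_abs U integrable_norm_sq) (auto simp: U_def zz)
  then have 1: "sqrt (\<delta> * (\<Sum>i=1..n. \<integral>\<omega>. \<bar>U i \<omega>\<bar> \<partial>M n)) \<le> sqrt (\<delta> * trace (C n))"
    using assms by simp
  have 2: "(\<Sum>i=1..n. \<integral>\<omega>. \<bar>U i \<omega>\<bar> * indicator {\<omega>. \<bar>U i \<omega>\<bar> \<ge> \<delta>} \<omega> \<partial>M n) \<le> Lf (sqrt \<delta>) n"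
    unfolding Lf_def
  proof (rule sum_mono)
    fix i assume i: "i \<in> {1..n}"
    have "norm z \<ge> sqrt \<delta>" if "\<bar>z $ j * z $ k\<bar> \<ge> \<delta>" for z :: "real^'d"
      using zz[of z] that by (intro real_le_lsqrt) auto
    then show "(\<integral>\<omega>. \<bar>U i \<omega>\<bar> * indicator {\<omega>. \<bar>U i \<omega>\<bar> \<ge> \<delta>} \<omega> \<partial>M n) \<le>
        (\<integral>\<omega>. (norm (Z n i \<omega>))\<^sup>2 * indicator {\<omega>. norm (Z n i \<omega>) \<ge> sqrt \<delta>} \<omega> \<partial>M n)"
      using truncated_le[OF i, of "U i" 1 "\<lambda>\<omega>. \<bar>U i \<omega>\<bar> \<ge> \<delta>" "sqrt \<delta>"] U(1)[OF i]
      by (auto simp: U_def zz)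
  qed
  show "(\<integral>\<omega>. \<bar>Q n \<omega> $ j $ k - C n $ j $ k\<bar> \<partial>M n) \<le> sqrt (\<delta> * trace (C n)) + 2 * Lf (sqrt \<delta>) n"
    unfolding eq
    using expectation_abs_sum_deviation_le[OF finite_atLeastAtMost indepU U(1) assms] 1 2 by linarith
qed

text \<open>The deviation splits into the fluctuation of \<open>Q n\<close>, the mean correction,
  whose expected norm before rescaling is \<open>trace (C n) / real n\<close>, and the deterministic
  error of the rescaled \<open>C n\<close>.\<close>

lemma A_deviation_bound:
  assumes "n \<ge> 2"
  shows "integrable (M n) (\<lambda>\<omega>. norm (A n \<omega> - \<Sigma>))"
    and "(\<integral>\<omega>. norm (A n \<omega> - \<Sigma>) \<partial>M n) \<le>
      (real n / (real n - 1)) * ((\<Sum>j\<in>UNIV. \<Sum>k\<in>UNIV. \<integral>\<omega>. \<bar>Q n \<omega> $ j $ k - C n $ j $ k\<bar> \<partial>M n) + trace (C n) / real n)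
      + norm ((real n / (real n - 1)) *\<^sub>R C n - \<Sigma>)"
proof -
  define r where "r = real n / (real n - 1)"
  have r: "r \<ge> 0" using assms by (simp add: r_def)
  define B where "B \<omega> = r * ((\<Sum>j\<in>UNIV. \<Sum>k\<in>UNIV. \<bar>Q n \<omega> $ j $ k - C n $ j $ k\<bar>)
    + (norm (S n \<omega>))\<^sup>2 / real n) + norm (r *\<^sub>R C n - \<Sigma>)" for \<omega>
  note int = Q_entry_bound(1)[OF zero_less_one]
  have B: "integrable (M n) B"
    unfolding B_def[abs_def]
    by (intro Bochner_Integration.integrable_add integrable_mult_right Bochner_Integration.integrable_sum
        int integrable_divide integrable_norm_S_sq integrable_const)
  have le: "norm (A n \<omega> - \<Sigma>) \<le> B \<omega>" for \<omega>
  proof -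
    have "A n \<omega> - \<Sigma> = r *\<^sub>R ((Q n \<omega> - C n) - (1 / real n) *\<^sub>R outer (S n \<omega>) (S n \<omega>)) + (r *\<^sub>R C n - \<Sigma>)"
      using sample_cov_eq[OF n, of "\<lambda>i. Z n i \<omega>"]
      by (simp add: A_def r_def S_def Q_def scaleR_diff_right)
    also have "norm \<dots> \<le> r * norm ((Q n \<omega> - C n) - (1 / real n) *\<^sub>R outer (S n \<omega>) (S n \<omega>)) + norm (r *\<^sub>R C n - \<Sigma>)"
      using r by (intro norm_triangle_le) simp
    also have "\<dots> \<le> r * (norm (Q n \<omega> - C n) + norm ((1 / real n) *\<^sub>R outer (S n \<omega>) (S n \<omega>))) + norm (r *\<^sub>R C n - \<Sigma>)"
      by (intro add_right_mono mult_left_mono norm_triangle_ineq4 r)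
    also have "\<dots> \<le> B \<omega>"
      unfolding B_def using norm_matrix_le_sum_abs[of "Q n \<omega> - C n"] r
      by (intro add_mono mult_left_mono order_refl) (auto simp: norm_outer)
    finally show ?thesis .
  qed
  show I: "integrable (M n) (\<lambda>\<omega>. norm (A n \<omega> - \<Sigma>))"
    by (rule Bochner_Integration.integrable_bound[OF B]) (use le in \<open>auto intro!: AE_I2 order_trans[OF le]\<close>)
  have "(\<integral>\<omega>. norm (A n \<omega> - \<Sigma>) \<partial>M n) \<le> (\<integral>\<omega>. B \<omega> \<partial>M n)"
    by (intro integral_mono I B le)
  also have "\<dots> = r * ((\<Sum>j\<in>UNIV. \<Sum>k\<in>UNIV. \<integral>\<omega>. \<bar>Q n \<omega> $ j $ k - C n $ j $ k\<bar> \<partial>M n) + trace (C n) / real n)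
      + norm (r *\<^sub>R C n - \<Sigma>)"
    unfolding B_def
    by (simp add: Bochner_Integration.integral_sum Bochner_Integration.integrable_sum int
        integrable_norm_S_sq expectation_norm_S_sq prob_space)
  finally show "(\<integral>\<omega>. norm (A n \<omega> - \<Sigma>) \<partial>M n) \<le>
      (real n / (real n - 1)) * ((\<Sum>j\<in>UNIV. \<Sum>k\<in>UNIV. \<integral>\<omega>. \<bar>Q n \<omega> $ j $ k - C n $ j $ k\<bar> \<partial>M n) + trace (C n) / real n)
      + norm ((real n / (real n - 1)) *\<^sub>R C n - \<Sigma>)"
    by (simp add: r_def)
qed

end

lemma char_S_tendsto:
  "(\<lambda>n. CLINT \<omega>|M n. iexp (t \<bullet> S n \<omega>)) \<longlonglongrightarrow> complex_of_real (exp (- ((t v* \<Sigma>) \<bullet> t) / 2))"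
proof -
  let ?s = "\<lambda>n. (t v* C n) \<bullet> t" and ?\<sigma> = "(t v* \<Sigma>) \<bullet> t"
  define T where "T = norm t + 1"
  have T: "T > 0" by (simp add: T_def add_nonneg_pos)
  have s: "?s \<longlonglongrightarrow> ?\<sigma>"
    by (rule bounded_linear.tendsto[OF bounded_linear_quadratic_form C_tendsto])
  have "(\<lambda>n. cmod ((CLINT \<omega>|M n. iexp (t \<bullet> S n \<omega>)) - exp (- ?s n / 2))) \<longlonglongrightarrow> 0"
  proof (rule tendsto_zero_iterated)
    fix \<mu> :: real assume \<mu>: "\<mu> > 0"
    show "\<forall>\<^sub>F n in sequentially. cmod ((CLINT \<omega>|M n. iexp (t \<bullet> S n \<omega>)) - exp (- ?s n / 2)) \<le>
        \<mu> * ?s n / 6 + T\<^sup>2 * Lf (\<mu> / T) n + (\<mu>\<^sup>2 + T\<^sup>2 * Lf (\<mu> / T) n) * ?s n"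
      using eventually_ge_at_top[of 1] by eventually_elim (unfold T_def, rule char_S_bound[OF _ \<mu>])
    show "(\<lambda>n. \<mu> * ?s n / 6 + T\<^sup>2 * Lf (\<mu> / T) n + (\<mu>\<^sup>2 + T\<^sup>2 * Lf (\<mu> / T) n) * ?s n) \<longlonglongrightarrow>
        \<mu> * ?\<sigma> / 6 + T\<^sup>2 * 0 + (\<mu>\<^sup>2 + T\<^sup>2 * 0) * ?\<sigma>"
      using T \<mu> by (intro tendsto_intros s Lf_tendsto) auto
  next
    \<comment> \<open>Once the Lindeberg terms are gone, what remains is of order \<mu>.\<close>
    have "((\<lambda>\<mu>. \<mu> * ?\<sigma> / 6 + T\<^sup>2 * 0 + (\<mu>\<^sup>2 + T\<^sup>2 * 0) * ?\<sigma>) \<longlongrightarrow> 0 * ?\<sigma> / 6 + T\<^sup>2 * 0 + (0\<^sup>2 + T\<^sup>2 * 0) * ?\<sigma>) (at_right 0)"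
      by (intro tendsto_intros) simp_all
    then show "((\<lambda>\<mu>. \<mu> * ?\<sigma> / 6 + T\<^sup>2 * 0 + (\<mu>\<^sup>2 + T\<^sup>2 * 0) * ?\<sigma>) \<longlongrightarrow> 0) (at_right 0)"
      by simp
  qed simp
  then have "(\<lambda>n. (CLINT \<omega>|M n. iexp (t \<bullet> S n \<omega>)) - complex_of_real (exp (- ?s n / 2))) \<longlonglongrightarrow> 0"
    by (simp add: tendsto_norm_zero_iff)
  moreover have "(\<lambda>n. complex_of_real (exp (- ?s n / 2))) \<longlonglongrightarrow> complex_of_real (exp (- ?\<sigma> / 2))"
    by (intro tendsto_intros s) simp
  ultimately show ?thesis
    using tendsto_add by fastforce
qed

lemma Q_entry_tendsto: "(\<lambda>n. \<integral>\<omega>. \<bar>Q n \<omega> $ j $ k - C n $ j $ k\<bar> \<partial>M n) \<longlonglongrightarrow> 0"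
proof (rule tendsto_zero_iterated)
  fix \<delta> :: real assume \<delta>: "\<delta> > 0"
  show "\<forall>\<^sub>F n in sequentially. (\<integral>\<omega>. \<bar>Q n \<omega> $ j $ k - C n $ j $ k\<bar> \<partial>M n) \<le> sqrt (\<delta> * trace (C n)) + 2 * Lf (sqrt \<delta>) n"
    using eventually_ge_at_top[of 1] by eventually_elim (rule Q_entry_bound(2)[OF _ \<delta>])
  show "(\<lambda>n. sqrt (\<delta> * trace (C n)) + 2 * Lf (sqrt \<delta>) n) \<longlonglongrightarrow> sqrt (\<delta> * trace \<Sigma>) + 2 * 0"
    using \<delta> by (intro tendsto_intros trace_C_tendsto Lf_tendsto) auto
next
  have "((\<lambda>\<delta>. sqrt (\<delta> * trace \<Sigma>) + 2 * 0) \<longlongrightarrow> sqrt (0 * trace \<Sigma>) + 2 * 0) (at_right 0)"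
    by (intro tendsto_intros)
  then show "((\<lambda>\<delta>. sqrt (\<delta> * trace \<Sigma>) + 2 * 0) \<longlongrightarrow> 0) (at_right 0)"
    by simp
qed simp

text \<open>Markov's inequality applied to the convergence in mean.\<close>

lemma A_tendsto_in_probability:
  assumes "\<epsilon> > 0"
  shows "(\<lambda>n. measure (M n) {\<omega> \<in> space (M n). norm (A n \<omega> - \<Sigma>) \<ge> \<epsilon>}) \<longlonglongrightarrow> 0"
proof (rule tendsto_sandwich[OF _ _ tendsto_const])
  let ?r = "\<lambda>n. real n / (real n - 1)"
  let ?b = "\<lambda>n. ?r n * ((\<Sum>j\<in>UNIV. \<Sum>k\<in>UNIV. \<integral>\<omega>. \<bar>Q n \<omega> $ j $ k - C n $ j $ k\<bar> \<partial>M n) + trace (C n) / real n)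
      + norm (?r n *\<^sub>R C n - \<Sigma>)"
  have "(\<lambda>n. 1 / (1 - 1 / real n)) \<longlonglongrightarrow> 1 / (1 - 0)"
    by (intro tendsto_intros lim_1_over_n) simp
  moreover have "\<forall>\<^sub>F n in sequentially. 1 / (1 - 1 / real n) = ?r n"
    using eventually_ge_at_top[of 2] by eventually_elim (simp add: field_simps)
  ultimately have r: "?r \<longlonglongrightarrow> 1"
    using Lim_transform_eventually by fastforce
  have "?b \<longlonglongrightarrow> 1 * ((\<Sum>j\<in>(UNIV::'d set). \<Sum>k\<in>(UNIV::'d set). 0) + 0) + norm (1 *\<^sub>R \<Sigma> - \<Sigma>)"
    by (intro tendsto_intros r Q_entry_tendsto C_tendsto
        tendsto_divide_0[OF trace_C_tendsto] filterlim_real_sequentially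
        filterlim_at_top_imp_at_infinity)
  then have "?b \<longlonglongrightarrow> 0" by simp
  then show "(\<lambda>n. ?b n / \<epsilon>) \<longlonglongrightarrow> 0"
    by (rule tendsto_divide_zero)
  show "\<forall>\<^sub>F n in sequentially. measure (M n) {\<omega> \<in> space (M n). norm (A n \<omega> - \<Sigma>) \<ge> \<epsilon>} \<le> ?b n / \<epsilon>"
    using eventually_ge_at_top[of 2]
  proof eventually_elim
    case (elim n)
    then have n: "n \<ge> 1" by simp
    have "measure (M n) {\<omega> \<in> space (M n). norm (A n \<omega> - \<Sigma>) \<ge> \<epsilon>} \<le> (\<integral>\<omega>. norm (A n \<omega> - \<Sigma>) \<partial>M n) / \<epsilon>"
      using assms by (intro integral_Markov_inequality_measure[where A = "{}"] A_deviation_bound(1)[OF n elim]) auto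
    also have "\<dots> \<le> ?b n / \<epsilon>"
      using A_deviation_bound(2)[OF n elim] assms by (intro divide_right_mono) auto
    finally show ?case .
  qed
qed simp

end

section \<open>Slutsky's lemma\<close>

text \<open>Where the two vectors are within \<epsilon>, the characters differ by at most
  \<open>norm t * \<epsilon>\<close>; elsewhere by at most 2. The hypotheses on \<open>Y\<close> are
  those of \<open>conv_in_distribution_by_char\<close>, which is then applied directly to
  \<open>X\<close>.\<close>

lemma conv_in_distribution_slutsky:
  fixes X Y :: "nat \<Rightarrow> 'a \<Rightarrow> 'b::euclidean_space"
  assumes XY: "\<forall>\<^sub>F n in sequentially. prob_space (M n) \<and> X n \<in> borel_measurable (M n) \<and> Y n \<in> borel_measurable (M n)"
    and N: "prob_space N" "sets N = sets borel"
    and char: "\<And>t. (\<lambda>n. CLINT \<omega>|M n. iexp (t \<bullet> Y n \<omega>)) \<longlonglongrightarrow> (CLINT x|N. iexp (t \<bullet> x))"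
    and tight: "\<And>e. e > 0 \<Longrightarrow>
      \<exists>K. \<forall>\<^sub>F n in sequentially. measure (M n) {\<omega> \<in> space (M n). norm (Y n \<omega>) > K} \<le> e"
    and diff: "\<And>\<epsilon>. \<epsilon> > 0 \<Longrightarrow> (\<lambda>n. measure (M n) {\<omega> \<in> space (M n). norm (X n \<omega> - Y n \<omega>) \<ge> \<epsilon>}) \<longlonglongrightarrow> 0"
  shows "conv_in_distribution M X N"
proof (rule conv_in_distribution_by_char[OF _ N])
  show "\<forall>\<^sub>F n in sequentially. prob_space (M n) \<and> X n \<in> borel_measurable (M n)"
    using XY by eventually_elim simp
next
  fix t :: 'b
  let ?P = "\<lambda>\<epsilon> n. measure (M n) {\<omega> \<in> space (M n). norm (X n \<omega> - Y n \<omega>) \<ge> \<epsilon>}"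
  have "(\<lambda>n. cmod ((CLINT \<omega>|M n. iexp (t \<bullet> X n \<omega>)) - (CLINT \<omega>|M n. iexp (t \<bullet> Y n \<omega>)))) \<longlonglongrightarrow> 0"
  proof (rule tendsto_zero_iterated)
    fix \<epsilon> :: real assume \<epsilon>: "\<epsilon> > 0"
    show "\<forall>\<^sub>F n in sequentially. cmod ((CLINT \<omega>|M n. iexp (t \<bullet> X n \<omega>)) - (CLINT \<omega>|M n. iexp (t \<bullet> Y n \<omega>))) \<le>
        norm t * \<epsilon> + 2 * ?P \<epsilon> n"
      using XY
    proof eventually_elim
      case (elim n)
      then interpret prob_space "M n" by simp
      have [measurable]: "X n \<in> borel_measurable (M n)" "Y n \<in> borel_measurable (M n)"
        using elim by auto
      let ?B = "{\<omega> \<in> space (M n). norm (X n \<omega> - Y n \<omega>) \<ge> \<epsilon>}"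
      have int: "integrable (M n) (\<lambda>\<omega>. iexp (t \<bullet> X n \<omega>))" "integrable (M n) (\<lambda>\<omega>. iexp (t \<bullet> Y n \<omega>))"
        by (intro integrable_const_bound[of _ 1]; simp)+
      have intB: "integrable (M n) (\<lambda>\<omega>. 2 * indicator ?B \<omega> :: real)"
        by (intro integrable_mult_right integrable_real_indicator) (auto simp: less_top[symmetric])
      have le: "cmod (iexp (t \<bullet> X n \<omega>) - iexp (t \<bullet> Y n \<omega>)) \<le> norm t * \<epsilon> + 2 * indicator ?B \<omega>"
        if "\<omega> \<in> space (M n)" for \<omega>
      proof (cases "norm (X n \<omega> - Y n \<omega>) \<ge> \<epsilon>")
        case True
        have "cmod (iexp (t \<bullet> X n \<omega>) - iexp (t \<bullet> Y n \<omega>)) \<le> cmod (iexp (t \<bullet> X n \<omega>)) + cmod (iexp (t \<bullet> Y n \<omega>))"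
          by (rule norm_triangle_ineq4)
        then have "cmod (iexp (t \<bullet> X n \<omega>) - iexp (t \<bullet> Y n \<omega>)) \<le> 2" by simp
        moreover have "norm t * \<epsilon> \<ge> 0" using \<epsilon> by simp
        ultimately show ?thesis
          using True that by simp
      next
        case False
        have "iexp (t \<bullet> X n \<omega>) - iexp (t \<bullet> Y n \<omega>) = iexp (t \<bullet> Y n \<omega>) * (iexp (t \<bullet> (X n \<omega> - Y n \<omega>)) - 1)"
          by (simp add: right_diff_distrib exp_add[symmetric] inner_diff_right)
        then have "cmod (iexp (t \<bullet> X n \<omega>) - iexp (t \<bullet> Y n \<omega>)) = cmod (iexp (t \<bullet> (X n \<omega> - Y n \<omega>)) - 1)"
          by (simp only: norm_mult norm_exp_i_times mult_1)
        also have "\<dots> \<le> \<bar>t \<bullet> (X n \<omega> - Y n \<omega>)\<bar>"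
          using iexp_approx1[of "t \<bullet> (X n \<omega> - Y n \<omega>)" 0] by simp
        also have "\<dots> \<le> norm t * norm (X n \<omega> - Y n \<omega>)"
          by (rule Cauchy_Schwarz_ineq2)
        also have "\<dots> \<le> norm t * \<epsilon>"
          using False by (intro mult_left_mono) auto
        finally show ?thesis
          using False by simp
      qed
      have "cmod ((CLINT \<omega>|M n. iexp (t \<bullet> X n \<omega>)) - (CLINT \<omega>|M n. iexp (t \<bullet> Y n \<omega>))) =
          cmod (CLINT \<omega>|M n. iexp (t \<bullet> X n \<omega>) - iexp (t \<bullet> Y n \<omega>))"
        using int by simp
      also have "\<dots> \<le> (\<integral>\<omega>. cmod (iexp (t \<bullet> X n \<omega>) - iexp (t \<bullet> Y n \<omega>)) \<partial>M n)"
        by (rule integral_norm_bound)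
      also have "\<dots> \<le> (\<integral>\<omega>. norm t * \<epsilon> + 2 * indicator ?B \<omega> \<partial>M n)"
        using int intB le
        by (intro integral_mono integrable_norm Bochner_Integration.integrable_diff
            Bochner_Integration.integrable_add) auto
      also have "\<dots> = norm t * \<epsilon> + 2 * ?P \<epsilon> n"
        using intB by (subst Bochner_Integration.integral_add) (auto simp: prob_space)
      finally show ?case .
    qed
    show "(\<lambda>n. norm t * \<epsilon> + 2 * ?P \<epsilon> n) \<longlonglongrightarrow> norm t * \<epsilon> + 2 * 0"
      by (intro tendsto_intros diff \<epsilon>)
  next
    have "((\<lambda>\<epsilon>. norm t * \<epsilon> + 2 * 0) \<longlongrightarrow> norm t * 0 + 2 * 0) (at_right 0)"
      by (intro tendsto_intros)
    then show "((\<lambda>\<epsilon>. norm t * \<epsilon> + 2 * 0) \<longlongrightarrow> 0) (at_right 0)" by simp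
  qed simp
  then have "(\<lambda>n. (CLINT \<omega>|M n. iexp (t \<bullet> X n \<omega>)) - (CLINT \<omega>|M n. iexp (t \<bullet> Y n \<omega>))) \<longlonglongrightarrow> 0"
    by (simp add: tendsto_norm_zero_iff)
  from tendsto_add[OF this char[of t]]
  show "(\<lambda>n. CLINT \<omega>|M n. iexp (t \<bullet> X n \<omega>)) \<longlonglongrightarrow> (CLINT x|N. iexp (t \<bullet> x))"
    by simp
next
  fix e :: real assume e: "e > 0"
  obtain K where K: "\<forall>\<^sub>F n in sequentially. measure (M n) {\<omega> \<in> space (M n). norm (Y n \<omega>) > K} \<le> e / 2"
    using tight[of "e / 2"] e by auto
  have "\<forall>\<^sub>F n in sequentially. measure (M n) {\<omega> \<in> space (M n). norm (X n \<omega> - Y n \<omega>) \<ge> 1} < e / 2"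
    using e by (intro order_tendstoD[OF diff]) auto
  with XY K have "\<forall>\<^sub>F n in sequentially. measure (M n) {\<omega> \<in> space (M n). norm (X n \<omega>) > K + 1} \<le> e"
  proof eventually_elim
    case (elim n)
    then interpret prob_space "M n" by simp
    have [measurable]: "X n \<in> borel_measurable (M n)" "Y n \<in> borel_measurable (M n)"
      using elim by auto
    have "norm (Y n \<omega>) > K \<or> norm (X n \<omega> - Y n \<omega>) \<ge> 1" if "norm (X n \<omega>) > K + 1" for \<omega>
      using norm_triangle_sub[of "X n \<omega>" "Y n \<omega>"] that by linarith
    then have "prob {\<omega> \<in> space (M n). norm (X n \<omega>) > K + 1} \<le>
        prob ({\<omega> \<in> space (M n). norm (Y n \<omega>) > K} \<union> {\<omega> \<in> space (M n). norm (X n \<omega> - Y n \<omega>) \<ge> 1})"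
      by (intro finite_measure_mono) auto
    also have "\<dots> \<le> prob {\<omega> \<in> space (M n). norm (Y n \<omega>) > K} + prob {\<omega> \<in> space (M n). norm (X n \<omega> - Y n \<omega>) \<ge> 1}"
      by (intro measure_Un_le) auto
    finally show ?case
      using elim by linarith
  qed
  then show "\<exists>K. \<forall>\<^sub>F n in sequentially. measure (M n) {\<omega> \<in> space (M n). norm (X n \<omega>) > K} \<le> e"
    by blast
qed

section \<open>Normalization by the sample covariance\<close>

lemma transpose_sample_cov: "transpose (sample_cov n z) = sample_cov n z"
  by (simp add: sample_cov_def transpose_def vec_eq_iff mult.commute)

context lindeberg_array
begin

lemma pos_def_A_iff: "n \<ge> 1 \<Longrightarrow> pos_def (A n \<omega>) \<longleftrightarrow> pos_def (sample_cov n (\<lambda>i. Z n i \<omega>))"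
  by (simp add: A_def pos_def_scaleR)

lemma transpose_A: "transpose (A n \<omega>) = A n \<omega>"
  by (simp add: A_def transpose_scalar transpose_sample_cov)

text \<open>\<open>A n \<omega>\<close> is symmetric and, with probability tending to one, so close
  to \<Sigma> that \<open>pos_def_near\<close> applies; positive scaling passes to
  \<open>sample_cov\<close>.\<close>

lemma prob_pos_def_tendsto:
  assumes "pos_def \<Sigma>"
  shows "(\<lambda>n. measure (M n) {\<omega> \<in> space (M n). pos_def (sample_cov n (\<lambda>i. Z n i \<omega>))}) \<longlonglongrightarrow> 1"
proof -
  obtain \<delta> where \<delta>: "\<delta> > 0" "\<And>A. transpose A = A \<Longrightarrow> norm (A - \<Sigma>) < \<delta> \<Longrightarrow> pos_def A"
    using pos_def_near[OF assms] by blast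
  let ?P = "\<lambda>n. measure (M n) {\<omega> \<in> space (M n). pos_def (sample_cov n (\<lambda>i. Z n i \<omega>))}"
  let ?Q = "\<lambda>n. measure (M n) {\<omega> \<in> space (M n). norm (A n \<omega> - \<Sigma>) \<ge> \<delta>}"
  show ?thesis
  proof (rule tendsto_sandwich[OF _ _ _ tendsto_const])
    show "\<forall>\<^sub>F n in sequentially. 1 - ?Q n \<le> ?P n"
      using eventually_ge_at_top[of 1]
    proof eventually_elim
      case (elim n)
      interpret prob_space "M n" using elim by (rule prob)
      note A_measurable[OF elim, measurable] sets_pos_def[measurable]
      have "{\<omega> \<in> space (M n). A n \<omega> \<in> {B. pos_def B}} \<in> sets (M n)"
        by measurable
      then have P: "{\<omega> \<in> space (M n). pos_def (sample_cov n (\<lambda>i. Z n i \<omega>))} \<in> sets (M n)"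
        by (simp add: pos_def_A_iff[OF elim])
      have "1 - ?Q n = prob (space (M n) - {\<omega> \<in> space (M n). norm (A n \<omega> - \<Sigma>) \<ge> \<delta>})"
        by (subst prob_compl) auto
      also have "\<dots> \<le> ?P n"
        using \<delta>(2)[OF transpose_A] P
        by (intro finite_measure_mono) (auto simp: pos_def_A_iff[OF elim, symmetric] not_le)
      finally show ?case .
    qed
    show "\<forall>\<^sub>F n in sequentially. ?P n \<le> 1"
      using eventually_ge_at_top[of 1] by eventually_elim (rule prob_space.prob_le_1[OF prob])
    show "(\<lambda>n. 1 - ?Q n) \<longlonglongrightarrow> 1"
      using tendsto_diff[OF tendsto_const[of 1] A_tendsto_in_probability[OF \<delta>(1)]] by simp
  qed
qed

lemma trace_C_bounded: "\<exists>B>0. \<forall>\<^sub>F n in sequentially. trace (C n) \<le> B"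
proof -
  have "\<forall>\<^sub>F n in sequentially. trace (C n) < \<bar>trace \<Sigma>\<bar> + 1"
    by (rule order_tendstoD[OF trace_C_tendsto]) linarith
  then show ?thesis
    by (intro exI[of _ "\<bar>trace \<Sigma>\<bar> + 1"]) (auto elim: eventually_mono)
qed

lemma tight_matrix_vector_mult_S:
  fixes G :: "real^'d^'d"
  assumes e: "e > 0"
  shows "\<exists>K. \<forall>\<^sub>F n in sequentially. measure (M n) {\<omega> \<in> space (M n). norm (G *v S n \<omega>) > K} \<le> e"
proof -
  obtain B where B: "B > 0" "\<forall>\<^sub>F n in sequentially. trace (C n) \<le> B"
    using trace_C_bounded by blast
  \<comment> \<open>Chosen so that Chebyshev's bound \<open>B / K\<^sup>2\<close> is exactly
    \<open>e\<close>.\<close>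
  define K where "K = sqrt (B / e)"
  have K: "K > 0" "K\<^sup>2 = B / e"
    using B e by (auto simp: K_def)
  have "\<forall>\<^sub>F n in sequentially. measure (M n) {\<omega> \<in> space (M n). norm (G *v S n \<omega>) > norm G * K} \<le> e"
    using B(2) eventually_ge_at_top[of 1]
  proof eventually_elim
    case (elim n)
    interpret prob_space "M n" using elim(2) by (rule prob)
    note S_measurable[OF elim(2), measurable]
    have "norm (S n \<omega>) \<ge> K" if "norm (G *v S n \<omega>) > norm G * K" for \<omega>
    proof (rule ccontr)
      assume "\<not> norm (S n \<omega>) \<ge> K"
      then have "norm G * norm (S n \<omega>) \<le> norm G * K"
        by (intro mult_left_mono) auto
      then show False
        using norm_matrix_vector_mult_le[of G "S n \<omega>"] that by linarith
    qed
    then have "prob {\<omega> \<in> space (M n). norm (G *v S n \<omega>) > norm G * K} \<le> prob {\<omega> \<in> space (M n). norm (S n \<omega>) \<ge> K}"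
      by (intro finite_measure_mono) auto
    also have "\<dots> \<le> trace (C n) / K\<^sup>2"
      by (rule prob_norm_S_ge_le[OF elim(2) K(1)])
    also have "\<dots> \<le> B / K\<^sup>2"
      using elim by (intro divide_right_mono) auto
    finally show ?case
      using K(2) B(1) by simp
  qed
  then show ?thesis by blast
qed

text \<open>A small factor times a tight one: if \<open>norm (S n \<omega>) < 1 / \<mu>\<close> and
  \<open>G (A n \<omega>)\<close> is within \<open>\<mu> * \<epsilon>\<close> of
  \<open>G \<Sigma>\<close>, the difference is below \<epsilon>. The first condition eventually
  fails with probability at most \<open>B * \<mu>\<^sup>2\<close>. \<open>X\<close> is prescribed
  only where \<open>A n \<omega>\<close> is positive definite, which closeness to \<Sigma>
  guarantees.\<close>

lemma normalized_diff_tendsto_in_probability: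
  fixes G :: "real^'d^'d \<Rightarrow> real^'d^'d"
  assumes pd: "pos_def \<Sigma>" and G: "continuous_on {A. pos_def A} G" and \<epsilon>: "\<epsilon> > 0"
    and X: "\<And>n \<omega>. n \<ge> 1 \<Longrightarrow> pos_def (A n \<omega>) \<Longrightarrow> X n \<omega> = G (A n \<omega>) *v S n \<omega>"
  shows "(\<lambda>n. measure (M n) {\<omega> \<in> space (M n). norm (X n \<omega> - G \<Sigma> *v S n \<omega>) \<ge> \<epsilon>}) \<longlonglongrightarrow> 0"
proof -
  obtain B where B: "B > 0" "\<forall>\<^sub>F n in sequentially. trace (C n) \<le> B"
    using trace_C_bounded by blast
  obtain \<delta>0 where \<delta>0: "\<delta>0 > 0" "\<And>A. transpose A = A \<Longrightarrow> norm (A - \<Sigma>) < \<delta>0 \<Longrightarrow> pos_def A"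
    using pos_def_near[OF pd] by blast
  have "\<exists>\<delta>>0. \<forall>A. transpose A = A \<longrightarrow> norm (A - \<Sigma>) < \<delta> \<longrightarrow> pos_def A \<and> norm (G A - G \<Sigma>) < \<mu> * \<epsilon>"
    if \<mu>: "\<mu> > 0" for \<mu>
  proof -
    obtain \<delta>1 where "\<delta>1 > 0" "\<And>A. pos_def A \<Longrightarrow> dist A \<Sigma> < \<delta>1 \<Longrightarrow> dist (G A) (G \<Sigma>) < \<mu> * \<epsilon>"
      using G pd \<mu> \<epsilon> unfolding continuous_on_iff by (metis mem_Collect_eq mult_pos_pos)
    then show ?thesis
      using \<delta>0 by (intro exI[of _ "min \<delta>0 \<delta>1"]) (auto simp: dist_norm)
  qed
  \<comment> \<open>The radius becomes a function of \<mu>, as \<open>tendsto_zero_iterated\<close>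
    takes a family of bounds indexed by \<mu>.\<close>
  then obtain \<delta> where \<delta>: "\<And>\<mu>. \<mu> > 0 \<Longrightarrow> \<delta> \<mu> > 0"
    "\<And>\<mu> A. \<mu> > 0 \<Longrightarrow> transpose A = A \<Longrightarrow> norm (A - \<Sigma>) < \<delta> \<mu> \<Longrightarrow> pos_def A \<and> norm (G A - G \<Sigma>) < \<mu> * \<epsilon>"
    by metis
  let ?Q = "\<lambda>\<mu> n. measure (M n) {\<omega> \<in> space (M n). norm (A n \<omega> - \<Sigma>) \<ge> \<delta> \<mu>}"
  show ?thesis
  proof (rule tendsto_zero_iterated)
    fix \<mu> :: real assume \<mu>: "\<mu> > 0"
    show "\<forall>\<^sub>F n in sequentially. measure (M n) {\<omega> \<in> space (M n). norm (X n \<omega> - G \<Sigma> *v S n \<omega>) \<ge> \<epsilon>} \<le>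
        B * \<mu>\<^sup>2 + ?Q \<mu> n"
      using B(2) eventually_ge_at_top[of 1]
    proof eventually_elim
      case (elim n)
      interpret prob_space "M n" using elim(2) by (rule prob)
      note S_measurable[OF elim(2), measurable] A_measurable[OF elim(2), measurable]
      have "norm (S n \<omega>) \<ge> 1 / \<mu> \<or> norm (A n \<omega> - \<Sigma>) \<ge> \<delta> \<mu>"
        if le: "norm (X n \<omega> - G \<Sigma> *v S n \<omega>) \<ge> \<epsilon>" for \<omega>
      proof (rule ccontr)
        assume "\<not> ?thesis"
        then have S: "norm (S n \<omega>) < 1 / \<mu>" and A: "norm (A n \<omega> - \<Sigma>) < \<delta> \<mu>" by auto
        from \<delta>(2)[OF \<mu> transpose_A A]
        have "X n \<omega> = G (A n \<omega>) *v S n \<omega>" and G: "norm (G (A n \<omega>) - G \<Sigma>) < \<mu> * \<epsilon>"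
          by (simp_all add: X[OF elim(2)])
        then have "norm (X n \<omega> - G \<Sigma> *v S n \<omega>) = norm ((G (A n \<omega>) - G \<Sigma>) *v S n \<omega>)"
          by (simp add: matrix_vector_mult_diff_rdistrib)
        also have "\<dots> \<le> norm (G (A n \<omega>) - G \<Sigma>) * norm (S n \<omega>)"
          by (rule norm_matrix_vector_mult_le)
        also have "\<dots> < (\<mu> * \<epsilon>) * (1 / \<mu>)"
          using G S by (intro mult_strict_mono') auto
        finally show False
          using le \<mu> by simp
      qed
      then have "prob {\<omega> \<in> space (M n). norm (X n \<omega> - G \<Sigma> *v S n \<omega>) \<ge> \<epsilon>} \<le>
          prob ({\<omega> \<in> space (M n). norm (S n \<omega>) \<ge> 1 / \<mu>} \<union> {\<omega> \<in> space (M n). norm (A n \<omega> - \<Sigma>) \<ge> \<delta> \<mu>})"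
        by (intro finite_measure_mono) auto
      also have "\<dots> \<le> prob {\<omega> \<in> space (M n). norm (S n \<omega>) \<ge> 1 / \<mu>} + ?Q \<mu> n"
        by (intro measure_Un_le) auto
      also have "prob {\<omega> \<in> space (M n). norm (S n \<omega>) \<ge> 1 / \<mu>} \<le> trace (C n) / (1 / \<mu>)\<^sup>2"
        using \<mu> by (intro prob_norm_S_ge_le elim) simp
      also have "\<dots> \<le> B / (1 / \<mu>)\<^sup>2"
        using elim by (intro divide_right_mono) auto
      also have "\<dots> = B * \<mu>\<^sup>2"
        by (simp add: power_divide)
      finally show ?case by simp
    qed
    show "(\<lambda>n. B * \<mu>\<^sup>2 + ?Q \<mu> n) \<longlonglongrightarrow> B * \<mu>\<^sup>2 + 0"
      by (intro tendsto_intros A_tendsto_in_probability \<delta>(1) \<mu>)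
  next
    have "((\<lambda>\<mu>. B * \<mu>\<^sup>2 + 0) \<longlongrightarrow> B * 0\<^sup>2 + 0) (at_right 0)"
      by (intro tendsto_intros)
    then show "((\<lambda>\<mu>. B * \<mu>\<^sup>2 + 0) \<longlongrightarrow> 0) (at_right 0)" by simp
  qed simp
qed

end

text \<open>The first conjunct makes the dummy value of the statistic harmless. The second is part
  of the claim because \<open>conv_in_distribution\<close> speaks of image measures, which are
  meaningful only for measurable maps.\<close>

theorem theorem3p1:
  fixes M :: "nat \<Rightarrow> 'a measure"
    and Z :: "nat \<Rightarrow> nat \<Rightarrow> 'a \<Rightarrow> real^('d::{finite,linorder})"
    and \<Sigma> :: "real^('d::{finite,linorder})^('d::{finite,linorder})"
    and R :: "real^('d::{finite,linorder})^('d::{finite,linorder}) \<Rightarrow> real^('d::{finite,linorder})^('d::{finite,linorder})"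
  assumes prob: "\<And>n. n \<ge> 1 \<Longrightarrow> prob_space (M n)"
    and indep: "\<And>n. n \<ge> 1 \<Longrightarrow> prob_space.indep_vars (M n) (\<lambda>_. borel) (Z n) {1..n}"
    and integrable: "\<And>n i. 1 \<le> i \<Longrightarrow> i \<le> n \<Longrightarrow> integrable (M n) (Z n i)"
    and mean_zero: "\<And>n i. 1 \<le> i \<Longrightarrow> i \<le> n \<Longrightarrow> integral\<^sup>L (M n) (Z n i) = 0"
    and cov_finite: "\<And>n i. 1 \<le> i \<Longrightarrow> i \<le> n \<Longrightarrow> cov_finite (M n) (Z n i)"
    and cov_lim: "(\<lambda>n. \<Sum>i=1..n. cov_matrix (M n) (Z n i)) \<longlonglongrightarrow> \<Sigma>"
    and pos_def: "pos_def \<Sigma>"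
    and lindeberg: "\<And>\<mu>::real. \<mu> > 0 \<Longrightarrow>
      (\<lambda>n. \<Sum>i=1..n. integral\<^sup>L (M n)
        (\<lambda>\<omega>. (norm (Z n i \<omega>))\<^sup>2 * indicator {\<omega>. norm (Z n i \<omega>) \<ge> \<mu>} \<omega>)) \<longlonglongrightarrow> 0"
    and root: "R = cholesky_sqrt \<or> R = symmetric_sqrt"
  shows "(\<lambda>n. measure (M n) {\<omega> \<in> space (M n). pos_def (sample_cov n (\<lambda>i. Z n i \<omega>))}) \<longlonglongrightarrow> 1
    \<and> (\<forall>n\<ge>1. (\<lambda>\<omega>. student_stat R n (\<lambda>i. Z n i \<omega>)) \<in> borel_measurable (M n))
    \<and> conv_in_distribution M (\<lambda>n \<omega>. student_stat R n (\<lambda>i. Z n i \<omega>)) std_normal_vec"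
proof (intro conjI allI impI)
  interpret lindeberg_array M Z \<Sigma>
    by (rule lindeberg_array.intro[OF prob indep integrable mean_zero cov_finite cov_lim lindeberg])
  let ?P = "{A :: ((real, 'd) vec, 'd) vec. pos_def A}"
  let ?G = "\<lambda>A. matrix_inv (R A)"
  let ?St = "\<lambda>n \<omega>. student_stat R n (\<lambda>i. Z n i \<omega>)"
  note G = inverse_sqrt_properties[OF root]
  show "(\<lambda>n. measure (M n) {\<omega> \<in> space (M n). pos_def (sample_cov n (\<lambda>i. Z n i \<omega>))}) \<longlonglongrightarrow> 1"
    by (rule prob_pos_def_tendsto[OF pos_def])
  show meas: "?St n \<in> borel_measurable (M n)" if n: "n \<ge> 1" for n
  proof -
    note Z_measurable[OF n, measurable]
    \<comment> \<open>The inverse root is known to be continuous only on positive definite matrices;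
      extended by zero it is Borel everywhere, and the extension reproduces the dummy value of the
      statistic.\<close>
    have G' [measurable]: "(\<lambda>A. indicator ?P A *\<^sub>R ?G A) \<in> borel_measurable borel"
      by (rule borel_measurable_continuous_on_indicator[OF sets_pos_def G(1)])
    have V [measurable]: "(\<lambda>\<omega>. sample_cov n (\<lambda>i. Z n i \<omega>)) \<in> borel_measurable (M n)"
      unfolding sample_cov_def sample_mean_def by measurable
    have "?St n = (\<lambda>\<omega>. sqrt (real n) *\<^sub>R
        ((indicator ?P (sample_cov n (\<lambda>i. Z n i \<omega>)) *\<^sub>R ?G (sample_cov n (\<lambda>i. Z n i \<omega>))) *v
          sample_mean n (\<lambda>i. Z n i \<omega>)))"
      by (auto simp: student_stat_def fun_eq_iff)
    also have "\<dots> \<in> borel_measurable (M n)"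
      using measurable_compose[OF V G'] unfolding sample_mean_def by measurable
    finally show ?thesis .
  qed
  \<comment> \<open>By homogeneity the inverse root of \<open>A n \<omega>\<close> is
    \<open>1 / sqrt n\<close> times that of the sample covariance; the same factor is left from
    \<open>sqrt n\<close> and the \<open>1 / n\<close> in the mean.\<close>
  have St: "?St n \<omega> = ?G (A n \<omega>) *v S n \<omega>" if n: "n \<ge> 1" and pd: "pos_def (A n \<omega>)" for n \<omega>
  proof -
    let ?V = "sample_cov n (\<lambda>i. Z n i \<omega>)"
    have V: "pos_def ?V"
      using pd by (simp add: pos_def_A_iff[OF n])
    have "?G (A n \<omega>) *v S n \<omega> = (1 / sqrt (real n)) *\<^sub>R (?G ?V *v S n \<omega>)"
      using n by (simp add: A_def G(2)[OF V] scaleR_matrix_vector_assoc)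
    moreover have "sqrt (real n) / real n = 1 / sqrt (real n)"
      using n by (simp add: field_simps)
    ultimately show ?thesis
      using V by (simp add: student_stat_def sample_mean_def S_def matrix_vector_mult_scaleR)
  qed
  show "conv_in_distribution M ?St std_normal_vec"
  proof (rule conv_in_distribution_slutsky[where Y = "\<lambda>n \<omega>. ?G \<Sigma> *v S n \<omega>"])
    show "\<forall>\<^sub>F n in sequentially. prob_space (M n) \<and> ?St n \<in> borel_measurable (M n) \<and>
        (\<lambda>\<omega>. ?G \<Sigma> *v S n \<omega>) \<in> borel_measurable (M n)"
      using eventually_ge_at_top[of 1]
    proof eventually_elim
      case (elim n)
      note S_measurable[OF elim, measurable]
      show ?case
        using prob[OF elim] meas[OF elim] by simp
    qed
    show "(\<lambda>n. CLINT \<omega>|M n. iexp (t \<bullet> (?G \<Sigma> *v S n \<omega>))) \<longlonglongrightarrow> (CLINT x|std_normal_vec. iexp (t \<bullet> x))" for t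
      \<comment> \<open>The matrix moves to the other side of the inner product, so the exponent is
        the form of \<Sigma> at \<open>t v* ?G \<Sigma>\<close>, which is
        \<open>(norm t)\<^sup>2\<close>.\<close>
      using char_S_tendsto[of "t v* ?G \<Sigma>"]
      unfolding G(3)[OF pos_def] char_std_normal_vec by (simp only: dot_lmul_matrix)
  qed (use prob_space_std_normal_vec sets_std_normal_vec tight_matrix_vector_mult_S
        normalized_diff_tendsto_in_probability[OF pos_def G(1) _ St] in auto)
qed

end
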